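(* Let $M$ be a tame matroid (possibly infinite). Then the following are equivalent: (1) $M$ is a thin sums matroid over $\mathbb{F}_2$. (2) For any circuit $o$ and cocircuit $b$ of $M$, $|o\cap b|$ is even. (3) For any circuit $o$ and cocircuit $b$ of $M$, $|o\cap b|\neq 3$. (4) $M$ has no minor isomorphic to $U_{2,4}$. (5) If $o_1,o_2$ are circuits of $M$ then $o_1\triangle o_2$ is empty or includes a circuit. (6) If $o_1,o_2$ are circuits of $M$ then $o_1\triangle o_2$ is a disjoint union of circuits. (7) If $(o_i\mid i\in I)$ is a finite family of circuits of $M$ then $\bigtriangleup_{i\in I}o_i$ is empty or includes a circuit. (8) If $(o_i\mid i\in I)$ is a finite family of circuits of $M$ then $\bigtriangleup_{i\in I}o_i$ is a disjoint union of circuits. (9) For any base $s$ of $M$ and any circuit $o$ of $M$, $o=\bigtriangleup_{e\in o\setminus s}o_e$, where $o_e$ is the fundamental circuit of $e$ with respect to $s$.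
   Context: Matroids may be infinite, in the following sense: a matroid on a set $E$ is given by a family $\mathcal{I}\subseteq\mathcal{P}(E)$ of independent sets such that (I1) $\emptyset\in\mathcal{I}$; (I2) $\mathcal{I}$ is closed under subsets; (I3) whenever $I,I'\in\mathcal{I}$ with $I'$ maximal and $I$ not maximal, there is $x\in I'\setminus I$ with $I\cup\{x\}\in\mathcal{I}$; (IM) whenever $I\subseteq X\subseteq E$ and $I\in\mathcal{I}$, the set $\{I'\in\mathcal{I}\mid I\subseteq I'\subseteq X\}$ has a maximal element. Bases are maximal independent sets, circuits are minimal dependent sets; the dual $M^*$ has as bases the complements of bases of $M$, and cocircuits of $M$ are circuits of $M^*$. Deletion $M\backslash D$ has as independent sets the independent sets of $M$ disjoint from $D$; contraction is $M/C=(M^*\backslash C)^*$; minors are matroids $M/C\backslash D$ with $C,D$ disjoint. A matroid is tame if every intersection of a circuit with a cocircuit is finite. For a base $s$ and $e\in E\setminus s$, the fundamental circuit of $e$ with respect to $s$ is the unique circuit contained in $s\cup\{e\}$. $U_{2,4}$ is the matroid on $4$ elements whose independent sets are the sets of size at most $2$. The symmetric difference $\bigtriangleup_{i\in I}X_i$ of a (possibly infinite) family of sets is the set of elements lying in an odd number of the $X_i$; it is defined only if each element lies in only finitely many of the $X_i$, and an equation involving it (as in (9)) includes the assertion that it is defined. A disjoint union of circuits may have any number of members (possibly infinitely many or none). Thin sums matroids over a field $k$: let $A$ be a set and $f=(f_e\mid e\in E)$ a family of functions $A\to k$. A family $\lambda=(\lambda_e\mid e\in E)$ of elements of $k$ is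 a thin dependence of $f$ if for each $a\in A$ we have $\sum_{e\in E}\lambda_e f_e(a)=0$, where this includes the requirement that only finitely many summands are nonzero. A set $I\subseteq E$ is thinly independent for $f$ if the only thin dependence of $f$ that is $0$ everywhere outside $I$ is the zero family. A matroid $M$ on $E$ is a thin sums matroid over $k$ if there are such $A$ and $f$ for which the independent sets of $M$ are precisely the thinly independent sets for $f$. *)

theory Defs
  imports Main "HOL-Library.Z2"
begin

definition maximal_sets :: "'a set set \<Rightarrow> 'a set set" where
  "maximal_sets F = {X \<in> F. \<forall>Y\<in>F. X \<subseteq> Y \<longrightarrow> Y = X}"

definition minimal_sets :: "'a set set \<Rightarrow> 'a set set" where
  "minimal_sets F = {X \<in> F. \<forall>Y\<in>F. Y \<subseteq> X \<longrightarrow> Y = X}"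

record 'a set_system =
  ground :: "'a set"
  indep :: "'a set set"

definition bases :: "'a set_system \<Rightarrow> 'a set set" where
  "bases M = maximal_sets (indep M)"

definition matroid :: "'a set_system \<Rightarrow> bool" where
  "matroid M \<longleftrightarrow>
     indep M \<subseteq> Pow (ground M) \<and>
     {} \<in> indep M \<and>
     (\<forall>I\<in>indep M. \<forall>J. J \<subseteq> I \<longrightarrow> J \<in> indep M) \<and>
     (\<forall>I\<in>indep M. \<forall>I'\<in>indep M. I' \<in> bases M \<and> I \<notin> bases M \<longrightarrow>
        (\<exists>x\<in>I' - I. I \<union> {x} \<in> indep M)) \<and>
     (\<forall>I X. I \<subseteq> X \<and> X \<subseteq> ground M \<and> I \<in> indep M \<longrightarrow>
        maximal_sets {I' \<in> indep M. I \<subseteq> I' \<and> I' \<subseteq> X} \<noteq> {})"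

definition circuits :: "'a set_system \<Rightarrow> 'a set set" where
  "circuits M = minimal_sets {X. X \<subseteq> ground M \<and> X \<notin> indep M}"

definition dual :: "'a set_system \<Rightarrow> 'a set_system" where
  "dual M = \<lparr>ground = ground M, indep = {J. \<exists>B\<in>bases M. J \<subseteq> ground M - B}\<rparr>"

definition cocircuits :: "'a set_system \<Rightarrow> 'a set set" where
  "cocircuits M = circuits (dual M)"

definition deletion :: "'a set_system \<Rightarrow> 'a set \<Rightarrow> 'a set_system" where
  "deletion M D = \<lparr>ground = ground M - D, indep = {J \<in> indep M. J \<inter> D = {}}\<rparr>"

definition contraction :: "'a set_system \<Rightarrow> 'a set \<Rightarrow> 'a set_system" where
  "contraction M C = dual (deletion (dual M) C)"

definition minors :: "'a set_system \<Rightarrow> 'a set_system set" where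
  "minors M = {deletion (contraction M C) D | C D.
                 C \<subseteq> ground M \<and> D \<subseteq> ground M \<and> C \<inter> D = {}}"

definition isomorphic :: "'a set_system \<Rightarrow> 'b set_system \<Rightarrow> bool" where
  "isomorphic M N \<longleftrightarrow> (\<exists>\<phi>. bij_betw \<phi> (ground M) (ground N) \<and>
     (\<forall>X. X \<subseteq> ground M \<longrightarrow> (X \<in> indep M \<longleftrightarrow> \<phi> ` X \<in> indep N)))"

definition uniform_matroid :: "nat \<Rightarrow> nat \<Rightarrow> nat set_system" where
  "uniform_matroid r n = \<lparr>ground = {..<n}, indep = {X. X \<subseteq> {..<n} \<and> card X \<le> r}\<rparr>"

definition tame :: "'a set_system \<Rightarrow> bool" where
  "tame M \<longleftrightarrow> (\<forall>C\<in>circuits M. \<forall>B\<in>cocircuits M. finite (C \<inter> B))"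

text \<open>Only meaningful if \<^term>\<open>s\<close> is a base and \<^term>\<open>e\<close> an element of the ground set outside \<^term>\<open>s\<close>.\<close>

definition fundamental_circuit :: "'a set_system \<Rightarrow> 'a set \<Rightarrow> 'a \<Rightarrow> 'a set" where
  "fundamental_circuit M s e = (THE C. C \<in> circuits M \<and> C \<subseteq> s \<union> {e})"

lemma bases_dual:
  assumes "indep M \<subseteq> Pow (ground M)"
  shows "bases (dual M) = (\<lambda>B. ground M - B) ` bases M"
proof -
  have dual_iff: "X \<in> bases (dual M) \<longleftrightarrow> (\<exists>B\<in>bases M. X \<subseteq> ground M - B) \<and>
      (\<forall>Y. (\<exists>B\<in>bases M. Y \<subseteq> ground M - B) \<longrightarrow> X \<subseteq> Y \<longrightarrow> Y = X)" for X
    by (simp add: bases_def[of "dual M"] maximal_sets_def[of "indep (dual M)"]) (simp add: dual_def)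
  have sub: "B \<subseteq> ground M" if "B \<in> bases M" for B
    using that assms by (auto simp: bases_def maximal_sets_def)
  have anti: "B = B'" if "B \<in> bases M" "B' \<in> bases M" "B \<subseteq> B'" for B B'
    using that by (auto simp: bases_def maximal_sets_def)
  show ?thesis
  proof (intro equalityI subsetI)
    fix X assume "X \<in> bases (dual M)"
    then obtain B where B: "B \<in> bases M" "X \<subseteq> ground M - B"
      and max: "\<And>Y. \<exists>B\<in>bases M. Y \<subseteq> ground M - B \<Longrightarrow> X \<subseteq> Y \<Longrightarrow> Y = X"
      unfolding dual_iff by blast
    then show "X \<in> (\<lambda>B. ground M - B) ` bases M"
      using max[of "ground M - B"] by auto
  next
    fix X assume "X \<in> (\<lambda>B. ground M - B) ` bases M"
    then obtain B where B: "B \<in> bases M" "X = ground M - B" by auto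
    have "Y = X" if "B' \<in> bases M" "Y \<subseteq> ground M - B'" "X \<subseteq> Y" for B' Y
    proof -
      have "B' \<subseteq> B" using that B sub by blast
      then have "B' = B" using anti that B by blast
      then show ?thesis using that B by blast
    qed
    then show "X \<in> bases (dual M)"
      using B unfolding dual_iff by blast
  qed
qed

definition symdiff_defined :: "'i set \<Rightarrow> ('i \<Rightarrow> 'a set) \<Rightarrow> bool" where
  "symdiff_defined I X \<longleftrightarrow> (\<forall>x. finite {i \<in> I. x \<in> X i})"

definition symdiff :: "'i set \<Rightarrow> ('i \<Rightarrow> 'a set) \<Rightarrow> 'a set" where
  "symdiff I X = {x. odd (card {i \<in> I. x \<in> X i})}"

definition disjoint_union_of_circuits :: "'a set_system \<Rightarrow> 'a set \<Rightarrow> bool" where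
  "disjoint_union_of_circuits M Y \<longleftrightarrow>
     (\<exists>\<C>. \<C> \<subseteq> circuits M \<and> pairwise disjnt \<C> \<and> \<Union>\<C> = Y)"

definition thin_dependence ::
    "'a set \<Rightarrow> 'b set \<Rightarrow> ('a \<Rightarrow> 'b \<Rightarrow> 'k::field) \<Rightarrow> ('a \<Rightarrow> 'k) \<Rightarrow> bool" where
  "thin_dependence E A f l \<longleftrightarrow> (\<forall>a\<in>A.
     finite {e \<in> E. l e * f e a \<noteq> 0} \<and>
     (\<Sum>e\<in>{e \<in> E. l e * f e a \<noteq> 0}. l e * f e a) = 0)"

definition thinly_independent ::
    "'a set \<Rightarrow> 'b set \<Rightarrow> ('a \<Rightarrow> 'b \<Rightarrow> 'k::field) \<Rightarrow> 'a set \<Rightarrow> bool" where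
  "thinly_independent E A f I \<longleftrightarrow> I \<subseteq> E \<and>
     (\<forall>l. thin_dependence E A f l \<and> (\<forall>e\<in>E - I. l e = 0) \<longrightarrow> (\<forall>e\<in>E. l e = 0))"

text \<open>
  HOL cannot quantify over the type of the index set \<open>A\<close>. Taking \<open>A\<close> to be a set of functions
  \<open>'a \<Rightarrow> 'k\<close> loses no generality, since elements \<open>a\<close> of \<open>A\<close> with the same row
  \<open>\<lambda>e. f e a\<close> may be identified; see \<open>thin_sums_matroidI\<close>.
\<close>

definition thin_sums_matroid :: "'k::field itself \<Rightarrow> 'a set_system \<Rightarrow> bool" where
  "thin_sums_matroid _ M \<longleftrightarrow> matroid M \<and>
     (\<exists>(A :: ('a \<Rightarrow> 'k) set) (f :: 'a \<Rightarrow> ('a \<Rightarrow> 'k) \<Rightarrow> 'k).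
        indep M = {I. thinly_independent (ground M) A f I})"

lemma thin_sums_matroidI:
  fixes A :: "'b set" and f :: "'a \<Rightarrow> 'b \<Rightarrow> 'k::field"
  assumes "matroid M" and "indep M = {I. thinly_independent (ground M) A f I}"
  shows "thin_sums_matroid TYPE('k) M"
proof -
  have "thin_dependence (ground M) ((\<lambda>a e. f e a) ` A) (\<lambda>e r. r e) l
          \<longleftrightarrow> thin_dependence (ground M) A f l" for l
    by (simp add: thin_dependence_def)
  then have "indep M =
      {I. thinly_independent (ground M) ((\<lambda>a e. f e a) ` A) (\<lambda>e r. r e) I}"
    using assms(2) by (simp add: thinly_independent_def)
  with assms(1) show ?thesis
    unfolding thin_sums_matroid_def by blast
qed

definition all_equivalent :: "bool list \<Rightarrow> bool" where
  "all_equivalent Ps \<longleftrightarrow> (\<forall>P\<in>set Ps. \<forall>Q\<in>set Ps. P \<longleftrightarrow> Q)"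

end

theory Submission
  imports Defs
begin

text \<open>
  Condition (2) implies (1), (8) and (9): the family of all cocircuits represents \<open>M\<close>; a set meeting
  every cocircuit evenly is empty or dependent, so a maximal disjoint family of circuits inside it
  exhausts it; and (9) says that a circuit meets all fundamental cocircuits of \<open>s\<close> evenly.
  Supports of sums of thin dependences are empty or dependent, so (1) implies (5), as do
  (6)--(8). Conversely (9), for a base meeting a cocircuit only once, gives (2).

  If \<open>C \<inter> b = {x, y, z}\<close>, there are a base \<open>s\<close> with \<open>C - {x} \<subseteq> s\<close> and \<open>s \<inter> b = {y, z}\<close> and an
  element \<open>k\<close> outside \<open>s \<union> b\<close> whose fundamental circuit \<open>D\<close> contains \<open>y\<close> and \<open>z\<close>. Contracting
  \<open>s - {y, z}\<close> and restricting to \<open>{x, y, z, k}\<close> gives \<open>U\<^sub>2\<^sub>,\<^sub>4\<close>, and the symmetric difference of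
  \<open>C\<close> and \<open>D\<close> is nonempty and independent; hence (4) and (5) imply (3). From (3), a descent on odd
  intersection sizes gives (2).

  Fundamental cocircuits are described by base exchange alone, so that it is never needed that the
  dual is a matroid.
\<close>

section \<open>Elementary descriptions of circuits, cocircuits and symmetric differences\<close>

text \<open>For a base \<open>s\<close> and \<open>y \<in> s\<close>, this is the fundamental
  circuit of \<open>y\<close> in the dual with respect to \<open>ground M - s\<close>.\<close>

definition fundamental_cocircuit :: "'a set_system \<Rightarrow> 'a set \<Rightarrow> 'a \<Rightarrow> 'a set" where
  "fundamental_cocircuit M s y =
     insert y {e \<in> ground M - s. insert e (s - {y}) \<in> indep M}"

lemma circuits_iff:
  "C \<in> circuits M \<longleftrightarrow>
     C \<subseteq> ground M \<and> C \<notin> indep M \<and> (\<forall>X. X \<subset> C \<longrightarrow> X \<in> indep M)"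
  unfolding circuits_def minimal_sets_def by blast

text \<open>A subset of the ground set is independent in the dual iff it misses a base, so
  cocircuits are the minimal subsets meeting every base.\<close>

lemma cocircuits_iff:
  "b \<in> cocircuits M \<longleftrightarrow>
     b \<subseteq> ground M \<and> (\<forall>B\<in>bases M. b \<inter> B \<noteq> {}) \<and>
     (\<forall>X. X \<subset> b \<longrightarrow> (\<exists>B\<in>bases M. X \<inter> B = {}))"
proof (cases "b \<subseteq> ground M")
  case True
  have "X \<in> indep (dual M) \<longleftrightarrow> (\<exists>B\<in>bases M. X \<inter> B = {})" if "X \<subseteq> b" for X
    using that True by (auto simp: dual_def)
  then have "b \<in> indep (dual M) \<longleftrightarrow> (\<exists>B\<in>bases M. b \<inter> B = {})"
    "(\<forall>X. X \<subset> b \<longrightarrow> X \<in> indep (dual M)) \<longleftrightarrow>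
      (\<forall>X. X \<subset> b \<longrightarrow> (\<exists>B\<in>bases M. X \<inter> B = {}))"
    by (simp_all add: psubset_eq)
  with True show ?thesis
    by (simp add: cocircuits_def circuits_iff) (simp add: dual_def)
next
  case False
  then show ?thesis
    by (simp add: cocircuits_def circuits_iff) (simp add: dual_def)
qed

lemma even_card_sym_diff:
  assumes "finite A" "finite B" "even (card A)" "even (card B)"
  shows "even (card (sym_diff A B))"
proof -
  have "card A = card (A - B) + card (A \<inter> B)" "card B = card (B - A) + card (A \<inter> B)"
    using assms card_Diff_subset_Int[of A B] card_Diff_subset_Int[of B A]
    by (simp_all add: Int_commute card_mono)
  moreover have "card (sym_diff A B) = card (A - B) + card (B - A)"
    using assms by (intro card_Un_disjoint) auto
  ultimately show ?thesis
    using assms by presburger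
qed

lemma of_nat_bit_eq_0_iff: "(of_nat n :: bit) = 0 \<longleftrightarrow> even n"
  by (induction n) auto

lemma symdiff_insert:
  assumes "finite I" "i \<notin> I"
  shows "symdiff (insert i I) X = sym_diff (X i) (symdiff I X)"
proof -
  have "card {j \<in> insert i I. x \<in> X j} = (if x \<in> X i then 1 else 0) + card {j \<in> I. x \<in> X j}" for x
  proof -
    have "{j \<in> insert i I. x \<in> X j} =
        (if x \<in> X i then insert i {j \<in> I. x \<in> X j} else {j \<in> I. x \<in> X j})"
      by auto
    then show ?thesis
      using assms by simp
  qed
  then show ?thesis
    unfolding symdiff_def by auto
qed

lemma fundamental_cocircuit_inter_base:
  assumes "y \<in> s"
  shows "fundamental_cocircuit M s y \<inter> s = {y}"
  using assms unfolding fundamental_cocircuit_def by blast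

lemma disjoint_union_of_circuits_cases:
  assumes "disjoint_union_of_circuits M Y"
  shows "Y = {} \<or> (\<exists>C\<in>circuits M. C \<subseteq> Y)"
  using assms unfolding disjoint_union_of_circuits_def by blast

section \<open>Bases: extension and exchange\<close>

context
  fixes M :: "'a set_system"
  assumes matroid: "matroid M"
begin

lemma indep_subset_ground: "I \<in> indep M \<Longrightarrow> I \<subseteq> ground M"
  using matroid by (auto simp: matroid_def)

lemma indep_mono: "I \<in> indep M \<Longrightarrow> J \<subseteq> I \<Longrightarrow> J \<in> indep M"
  using matroid by (simp add: matroid_def)

lemma empty_indep: "{} \<in> indep M"
  using matroid by (simp add: matroid_def)

lemma base_indep: "s \<in> bases M \<Longrightarrow> s \<in> indep M"
  unfolding bases_def maximal_sets_def by blast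

lemma base_subset_eq: "s \<in> bases M \<Longrightarrow> I \<in> indep M \<Longrightarrow> s \<subseteq> I \<Longrightarrow> I = s"
  unfolding bases_def maximal_sets_def by blast

lemma base_insert_dependent: "s \<in> bases M \<Longrightarrow> e \<notin> s \<Longrightarrow> insert e s \<notin> indep M"
  using base_subset_eq by blast

lemma augment_from_base:
  assumes "I \<in> indep M" "I \<notin> bases M" "s \<in> bases M"
  obtains x where "x \<in> s - I" "insert x I \<in> indep M"
proof -
  have "\<exists>x\<in>s - I. I \<union> {x} \<in> indep M"
    using matroid assms base_indep[OF assms(3)] by (simp add: matroid_def)
  then show ?thesis
    using that by auto
qed

lemma extend_within:
  assumes "I \<in> indep M" "I \<subseteq> X" "X \<subseteq> ground M"
  obtains J where "J \<in> indep M" "I \<subseteq> J" "J \<subseteq> X"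
    "\<forall>x\<in>X. insert x J \<in> indep M \<longrightarrow> x \<in> J"
proof -
  have "maximal_sets {I' \<in> indep M. I \<subseteq> I' \<and> I' \<subseteq> X} \<noteq> {}"
    using matroid assms by (simp add: matroid_def)
  then obtain J where J: "J \<in> indep M" "I \<subseteq> J" "J \<subseteq> X"
    and max: "\<forall>K\<in>indep M. I \<subseteq> K \<longrightarrow> K \<subseteq> X \<longrightarrow> J \<subseteq> K \<longrightarrow> K = J"
    unfolding maximal_sets_def by auto
  have "x \<in> J" if "x \<in> X" "insert x J \<in> indep M" for x
    using bspec[OF max that(2)] J that(1) by blast
  with J that show ?thesis
    by simp
qed

text \<open>A maximal independent set between \<open>I\<close> and \<open>X\<close> is already a
  base: otherwise the augmentation axiom would add an element of \<open>s0\<close>, which lies in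
  \<open>X\<close>.\<close>

lemma extend_within_to_base:
  assumes "I \<in> indep M" "I \<subseteq> X" "X \<subseteq> ground M" "s0 \<in> bases M" "s0 \<subseteq> X"
  obtains s where "s \<in> bases M" "I \<subseteq> s" "s \<subseteq> X"
proof -
  obtain s where s: "s \<in> indep M" "I \<subseteq> s" "s \<subseteq> X"
    "\<forall>x\<in>X. insert x s \<in> indep M \<longrightarrow> x \<in> s"
    by (rule extend_within[OF assms(1-3)])
  have "s \<in> bases M"
  proof (rule ccontr)
    assume "s \<notin> bases M"
    then obtain x where "x \<in> s0 - s" "insert x s \<in> indep M"
      using augment_from_base[OF s(1) _ assms(4)] by blast
    with s(4) assms(5) show False
      by blast
  qed
  with s that show ?thesis
    by blast
qed

lemma extend_to_base:
  assumes "I \<in> indep M"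
  obtains s where "s \<in> bases M" "I \<subseteq> s"
proof -
  obtain s where s: "s \<in> indep M" "I \<subseteq> s" "s \<subseteq> ground M"
    "\<forall>x\<in>ground M. insert x s \<in> indep M \<longrightarrow> x \<in> s"
    by (rule extend_within[OF assms indep_subset_ground[OF assms] subset_refl])
  have "K = s" if "K \<in> indep M" "s \<subseteq> K" for K
  proof -
    have "x \<in> s" if "x \<in> K" for x
    proof -
      have "insert x s \<in> indep M"
        by (rule indep_mono[OF \<open>K \<in> indep M\<close>]) (use that \<open>s \<subseteq> K\<close> in simp)
      moreover have "x \<in> ground M"
        using indep_subset_ground[OF \<open>K \<in> indep M\<close>] that by blast
      ultimately show ?thesis
        using s(4) by simp
    qed
    with that show ?thesis
      by blast
  qed
  then have "s \<in> bases M"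
    using s(1) unfolding bases_def maximal_sets_def by blast
  with s(2) that show ?thesis
    by blast
qed

text \<open>Were the new set not a base, augmenting it from \<open>s\<close> could only add
  \<open>y\<close> back, making \<open>insert e s\<close> independent.\<close>

lemma swap_base:
  assumes "s \<in> bases M" "y \<in> s" "e \<notin> s" "insert e (s - {y}) \<in> indep M"
  shows "insert e (s - {y}) \<in> bases M"
proof (rule ccontr)
  assume "insert e (s - {y}) \<notin> bases M"
  then obtain x where "x \<in> s - insert e (s - {y})" "insert x (insert e (s - {y})) \<in> indep M"
    using augment_from_base[OF assms(4) _ assms(1)] by blast
  moreover from this have "insert e s = insert x (insert e (s - {y}))"
    by blast
  ultimately have "insert e s \<in> indep M"
    by simp
  with assms base_insert_dependent show False
    by blast
qed

lemma base_exchange: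
  assumes "s \<in> bases M" "t \<in> bases M" "y \<in> s" "y \<notin> t"
  obtains e where "e \<in> t - s" "insert e (s - {y}) \<in> indep M"
proof -
  have "s - {y} \<in> indep M"
    using indep_mono[OF base_indep[OF assms(1)]] by blast
  moreover have "s - {y} \<notin> bases M"
    using base_subset_eq[of "s - {y}" s] base_indep[OF assms(1)] assms(3) by blast
  ultimately obtain e where "e \<in> t - (s - {y})" "insert e (s - {y}) \<in> indep M"
    using augment_from_base[OF _ _ assms(2)] by blast
  with assms(4) that show ?thesis
    by blast
qed

section \<open>Fundamental circuits and cocircuits\<close>

text \<open>Exchange gives the circuit explicitly, as \<open>e\<close> with all elements of
  \<open>s\<close> that it can replace: leaving out any element gives a subset of a known
  independent set.\<close>

lemma fundamental_circuit_exists: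
  assumes "s \<in> bases M" "e \<in> ground M" "e \<notin> s"
  shows "insert e {y \<in> s. insert e (s - {y}) \<in> indep M} \<in> circuits M"
proof -
  let ?C = "insert e {y \<in> s. insert e (s - {y}) \<in> indep M}"
  have ground: "insert e s \<subseteq> ground M"
    using assms base_indep indep_subset_ground by blast
  have "?C \<notin> indep M"
  proof
    assume "?C \<in> indep M"
    then obtain t where t: "t \<in> bases M" "?C \<subseteq> t" "t \<subseteq> insert e s"
      using extend_within_to_base[of ?C "insert e s" s] ground assms(1) by blast
    then have "e \<in> t"
      by blast
    \<comment> \<open>Exchanging \<open>e\<close> out of \<open>t\<close> leads to a base inside
      \<open>s\<close>, hence to \<open>s\<close> itself. So \<open>t\<close> is
      \<open>insert e (s - {z})\<close>, and \<open>z\<close> is replaceable though it is missing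
      from \<open>t\<close>.\<close>
    then obtain z where z: "z \<in> s - t" "insert z (t - {e}) \<in> indep M"
      using base_exchange[OF t(1) assms(1) _ assms(3)] by blast
    then have "insert z (t - {e}) \<in> bases M"
      using swap_base[OF t(1) \<open>e \<in> t\<close>] by blast
    moreover have "insert z (t - {e}) \<subseteq> s"
      using z(1) t(3) by blast
    ultimately have "insert z (t - {e}) = s"
      using base_subset_eq base_indep[OF assms(1)] by metis
    then have "insert e (s - {z}) \<subseteq> t"
      using \<open>e \<in> t\<close> by blast
    then have "z \<in> ?C"
      using z(1) indep_mono base_indep[OF t(1)] by blast
    with t(2) z(1) show False
      by blast
  qed
  moreover have "X \<in> indep M" if X: "X \<subset> ?C" for X
  proof -
    obtain y where y: "y \<in> ?C" "y \<notin> X"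
      using psubset_imp_ex_mem[OF X] by blast
    show ?thesis
    proof (cases "y = e")
      case True
      then have "X \<subseteq> s"
        using y that by blast
      then show ?thesis
        using indep_mono base_indep[OF assms(1)] by blast
    next
      case False
      then have "X \<subseteq> insert e (s - {y})" "insert e (s - {y}) \<in> indep M"
        using y that by auto
      then show ?thesis
        using indep_mono by blast
    qed
  qed
  ultimately show ?thesis
    using ground unfolding circuits_iff by blast
qed

text \<open>Were \<open>e\<close> or a replaceable element missing, the circuit would lie in an
  independent set. So it includes the fundamental circuit, and comparable circuits are
  equal.\<close>

lemma circuit_eq_fundamental_set:
  assumes "s \<in> bases M" "e \<in> ground M" "e \<notin> s" "C \<in> circuits M" "C \<subseteq> insert e s"
  shows "C = insert e {y \<in> s. insert e (s - {y}) \<in> indep M}"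
proof -
  let ?C = "insert e {y \<in> s. insert e (s - {y}) \<in> indep M}"
  have dep: "C \<notin> indep M"
    using assms(4) circuits_iff by blast
  have "y \<in> C" if "y \<in> ?C" for y
  proof (rule ccontr)
    assume "y \<notin> C"
    then have "C \<subseteq> s \<or> (C \<subseteq> insert e (s - {y}) \<and> insert e (s - {y}) \<in> indep M)"
      using that assms(5) by blast
    with dep indep_mono base_indep[OF assms(1)] show False
      by blast
  qed
  then have "?C \<subseteq> C"
    by blast
  with fundamental_circuit_exists[OF assms(1-3)] assms(4) show ?thesis
    unfolding circuits_iff by blast
qed

lemma fundamental_circuit_eq:
  assumes "s \<in> bases M" "e \<in> ground M" "e \<notin> s"
  shows "fundamental_circuit M s e = insert e {y \<in> s. insert e (s - {y}) \<in> indep M}"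
  unfolding fundamental_circuit_def
  using fundamental_circuit_exists[OF assms] circuit_eq_fundamental_set[OF assms]
  by (intro the_equality) auto

lemma fundamental_circuit_circuit:
  assumes "s \<in> bases M" "e \<in> ground M" "e \<notin> s"
  shows "fundamental_circuit M s e \<in> circuits M"
  using fundamental_circuit_eq[OF assms] fundamental_circuit_exists[OF assms] by simp

lemma fundamental_circuit_unique:
  assumes "s \<in> bases M" "e \<in> ground M" "e \<notin> s" "C \<in> circuits M" "C \<subseteq> insert e s"
  shows "fundamental_circuit M s e = C"
  using fundamental_circuit_eq[OF assms(1-3)] circuit_eq_fundamental_set[OF assms] by simp

text \<open>Infinitely many elements may have to go, so the circuit is not found by removal but as
  the fundamental circuit of some \<open>e\<close> in \<open>X\<close> outside a maximal independent
  subset \<open>I\<close> of \<open>X\<close>.\<close>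

lemma dependent_includes_circuit:
  assumes "X \<subseteq> ground M" "X \<notin> indep M"
  obtains C where "C \<in> circuits M" "C \<subseteq> X"
proof -
  obtain I where I: "I \<in> indep M" "{} \<subseteq> I" "I \<subseteq> X"
    "\<forall>x\<in>X. insert x I \<in> indep M \<longrightarrow> x \<in> I"
    by (rule extend_within[OF empty_indep empty_subsetI assms(1)])
  moreover have "I \<noteq> X"
    using I(1) assms(2) by blast
  ultimately obtain e where e: "e \<in> X" "e \<notin> I"
    by blast
  then have dep: "insert e I \<notin> indep M"
    using I(4) by blast
  obtain s where s: "s \<in> bases M" "I \<subseteq> s"
    using extend_to_base[OF I(1)] .
  have "e \<notin> s"
    using dep s indep_mono[OF base_indep[OF s(1)], of "insert e I"] by blast
  \<comment> \<open>Removing some \<open>y\<close> outside \<open>I\<close> from the base leaves the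
    dependent set \<open>insert e I\<close> intact, so \<open>e\<close> cannot replace
    \<open>y\<close>.\<close>
  moreover have "y \<in> I" if "y \<in> s" "insert e (s - {y}) \<in> indep M" for y
    using indep_mono[OF that(2), of "insert e I"] dep s(2) by blast
  ultimately show ?thesis
    using that fundamental_circuit_exists[OF s(1), of e] e(1) assms(1) I(3) by blast
qed

text \<open>Exchange makes it meet every base. For minimality, it misses \<open>s\<close> once
  \<open>y\<close> is dropped, and the base \<open>insert z (s - {y})\<close> once another
  \<open>z\<close> is dropped.\<close>

lemma fundamental_cocircuit_cocircuit:
  assumes "s \<in> bases M" "y \<in> s"
  shows "fundamental_cocircuit M s y \<in> cocircuits M"
proof -
  let ?b = "fundamental_cocircuit M s y"
  have "?b \<subseteq> ground M"
    using assms base_indep indep_subset_ground unfolding fundamental_cocircuit_def by blast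
  moreover have "?b \<inter> t \<noteq> {}" if t: "t \<in> bases M" for t
  proof (cases "y \<in> t")
    case True
    then show ?thesis
      unfolding fundamental_cocircuit_def by blast
  next
    case False
    then obtain e where "e \<in> t - s" "insert e (s - {y}) \<in> indep M"
      using base_exchange[OF assms(1) t assms(2)] by blast
    then show ?thesis
      using indep_subset_ground[OF base_indep[OF that]] unfolding fundamental_cocircuit_def by blast
  qed
  moreover have "\<exists>t\<in>bases M. X \<inter> t = {}" if X: "X \<subset> ?b" for X
  proof -
    obtain z where z: "z \<in> ?b" "z \<notin> X"
      using psubset_imp_ex_mem[OF X] by blast
    show ?thesis
    proof (cases "z = y")
      case True
      then have "X \<inter> s = {}"
        using z that unfolding fundamental_cocircuit_def by blast
      then show ?thesis
        using assms(1) by blast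
    next
      case False
      then have z': "z \<notin> s" "insert z (s - {y}) \<in> indep M"
        using z unfolding fundamental_cocircuit_def by auto
      have "X \<inter> insert z (s - {y}) = {}"
        using z that unfolding fundamental_cocircuit_def by blast
      then show ?thesis
        using swap_base[OF assms z'] by blast
    qed
  qed
  ultimately show ?thesis
    unfolding cocircuits_iff by blast
qed

lemma cocircuit_meets_base_once:
  assumes "b \<in> cocircuits M" "x \<in> b"
  obtains s where "s \<in> bases M" "s \<inter> b = {x}"
proof -
  have "b - {x} \<subset> b"
    using assms(2) by blast
  then obtain s where "s \<in> bases M" "(b - {x}) \<inter> s = {}"
    using assms(1) cocircuits_iff by metis
  moreover from this have "b \<inter> s \<noteq> {}"
    using assms(1) cocircuits_iff by blast
  ultimately show ?thesis
    using that by blast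
qed

text \<open>A base obtained from \<open>s\<close> by replacing \<open>x\<close> can meet
  \<open>b\<close> only in the new element, which thus lies in \<open>b\<close>. Comparable
  cocircuits are equal.\<close>

lemma cocircuit_eq_fundamental:
  assumes "b \<in> cocircuits M" "s \<in> bases M" "s \<inter> b = {x}"
  shows "fundamental_cocircuit M s x = b"
proof -
  have x: "x \<in> s" "x \<in> b"
    using assms(3) by auto
  have "e \<in> b" if "e \<in> ground M - s" "insert e (s - {x}) \<in> indep M" for e
  proof -
    have "insert e (s - {x}) \<in> bases M"
      using swap_base[OF assms(2) x(1) _ that(2)] that(1) by blast
    then have "b \<inter> insert e (s - {x}) \<noteq> {}"
      using assms(1) cocircuits_iff by blast
    then show ?thesis
      using assms(3) by blast
  qed
  then have "fundamental_cocircuit M s x \<subseteq> b"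
    using x unfolding fundamental_cocircuit_def by blast
  then show ?thesis
    using fundamental_cocircuit_cocircuit[OF assms(2) x(1)] assms(1)
    unfolding cocircuits_def circuits_iff by blast
qed

text \<open>Both sides say that \<open>e\<close> can replace \<open>y\<close> in \<open>s\<close>;
  this duality links circuits to cocircuits throughout.\<close>

lemma mem_fundamental_circuit_iff:
  assumes "s \<in> bases M" "e \<in> ground M" "e \<notin> s" "y \<in> s"
  shows "y \<in> fundamental_circuit M s e \<longleftrightarrow> e \<in> fundamental_cocircuit M s y"
  using assms fundamental_circuit_eq[OF assms(1-3)] by (auto simp: fundamental_cocircuit_def)

section \<open>Intersections of circuits with cocircuits\<close>

text \<open>A maximal independent set that includes \<open>C - {x}\<close> and avoids
  \<open>b\<close> is not a base. Augmenting it from a base that meets \<open>b\<close> only in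
  \<open>x\<close> must add \<open>x\<close>, which makes \<open>C\<close> independent.\<close>

lemma circuit_cocircuit_inter_not_singleton:
  assumes "C \<in> circuits M" "b \<in> cocircuits M"
  shows "C \<inter> b \<noteq> {x}"
proof
  assume Cb: "C \<inter> b = {x}"
  then obtain s where s: "s \<in> bases M" "s \<inter> b = {x}"
    using cocircuit_meets_base_once[OF assms(2)] by blast
  have C: "C - {x} \<in> indep M" "C - {x} \<subseteq> ground M - b"
    using assms(1) Cb unfolding circuits_iff by blast+
  obtain I where I: "I \<in> indep M" "C - {x} \<subseteq> I" "I \<subseteq> ground M - b"
    "\<forall>z\<in>ground M - b. insert z I \<in> indep M \<longrightarrow> z \<in> I"
    by (rule extend_within[OF C Diff_subset])
  have "b \<inter> I = {}"
    using I(3) by blast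
  then have "I \<notin> bases M"
    using assms(2) unfolding cocircuits_iff by blast
  then obtain z where z: "z \<in> s - I" "insert z I \<in> indep M"
    using augment_from_base[OF I(1)] s(1) by blast
  have "z \<in> b"
    using I(4) z indep_subset_ground by blast
  then have "z = x"
    using s(2) z(1) by blast
  then have "C \<subseteq> insert z I"
    using I(2) by blast
  then show False
    using indep_mono[OF z(2)] assms(1) unfolding circuits_iff by blast
qed

text \<open>Deleting \<open>b - C\<close> leaves a spanning set as soon as \<open>C \<inter> b\<close> has an element other than \<open>x\<close>,
  so \<open>C - {x}\<close> extends to a base without using further elements of \<open>b\<close>.\<close>

lemma base_adapted_to_circuit_cocircuit:
  assumes "C \<in> circuits M" "b \<in> cocircuits M" "x \<in> C \<inter> b"
  obtains s where "s \<in> bases M" "C - {x} \<subseteq> s" "s \<inter> b = C \<inter> b - {x}" "x \<notin> s"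
    "fundamental_circuit M s x = C"
proof -
  obtain y where y: "y \<in> C \<inter> b" "y \<noteq> x"
    using circuit_cocircuit_inter_not_singleton[OF assms(1,2), of x] assms(3) by blast
  obtain s0 where s0: "s0 \<in> bases M" "s0 \<inter> b = {y}"
    using cocircuit_meets_base_once[OF assms(2)] y(1) by blast
  let ?X = "(ground M - b) \<union> (C - {x})"
  have "C - {x} \<in> indep M" "?X \<subseteq> ground M"
    using assms unfolding circuits_iff by blast+
  moreover have "s0 \<subseteq> ?X"
    using s0(2) y indep_subset_ground[OF base_indep[OF s0(1)]] by auto
  ultimately obtain s where s: "s \<in> bases M" "C - {x} \<subseteq> s" "s \<subseteq> ?X"
    using extend_within_to_base[of "C - {x}" ?X s0] s0(1) by blast
  have "s \<inter> b = C \<inter> b - {x}" "x \<notin> s"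
    using s assms(3) by blast+
  moreover have "fundamental_circuit M s x = C"
  proof (rule fundamental_circuit_unique)
    show "x \<in> ground M" "C \<subseteq> insert x s"
      using assms s(2) unfolding circuits_iff by blast+
  qed (use s calculation assms in auto)
  ultimately show ?thesis
    using that s by blast
qed

text \<open>\<open>z\<close> is exchanged against a base that meets \<open>b\<close> only in
  \<open>y\<close>; as \<open>y\<close> is in \<open>s\<close> already, the new element avoids
  \<open>b\<close>.\<close>

lemma element_avoiding_cocircuit:
  assumes "b \<in> cocircuits M" "s \<in> bases M" "y \<in> s \<inter> b" "z \<in> s \<inter> b" "y \<noteq> z"
  obtains k where "k \<in> ground M" "k \<notin> s" "k \<notin> b" "z \<in> fundamental_circuit M s k"
proof -
  obtain s0 where s0: "s0 \<in> bases M" "s0 \<inter> b = {y}"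
    using cocircuit_meets_base_once[OF assms(1)] assms(3) by blast
  then have "z \<notin> s0"
    using assms(4,5) by auto
  then obtain k where k: "k \<in> s0 - s" "insert k (s - {z}) \<in> indep M"
    using base_exchange[OF assms(2) s0(1)] assms(4) by blast
  have "k \<in> ground M" "k \<notin> b"
    using k(1) s0(2) assms(3) indep_subset_ground[OF base_indep[OF s0(1)]] by auto
  then show ?thesis
    using that k assms fundamental_circuit_eq[OF assms(2)] by auto
qed

lemma fundamental_circuit_subset:
  assumes "s \<in> bases M" "e \<in> ground M" "e \<notin> s"
  shows "fundamental_circuit M s e \<subseteq> insert e s" "e \<in> fundamental_circuit M s e"
  using fundamental_circuit_eq[OF assms] by auto

text \<open>These data serve both to build a minor isomorphic to \<open>U_{2,4}\<close> and to find
  two circuits with nonempty independent symmetric difference.\<close>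

lemma three_element_intersection_configuration:
  assumes "C \<in> circuits M" "b \<in> cocircuits M" "card (C \<inter> b) = 3"
  obtains s x y z k where "s \<in> bases M" "card {x, y, z, k} = 4" "y \<in> s" "z \<in> s" "x \<notin> s" "k \<notin> s"
    "{x, y, z, k} \<subseteq> ground M" "fundamental_circuit M s x = C"
    "{y, z} \<subseteq> C" "{y, z} \<subseteq> fundamental_circuit M s k"
    "insert x (insert k (s - {y, z})) \<in> indep M"
proof -
  obtain x y z where xyz: "C \<inter> b = {x, y, z}" "x \<noteq> y" "x \<noteq> z" "y \<noteq> z"
    using assms(3) unfolding card_3_iff by blast
  obtain s where s: "s \<in> bases M" "C - {x} \<subseteq> s" "s \<inter> b = C \<inter> b - {x}" "x \<notin> s"
    "fundamental_circuit M s x = C"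
    using base_adapted_to_circuit_cocircuit[OF assms(1,2), of x] xyz(1) by blast
  have sb: "s \<inter> b = {y, z}"
    using s(3) xyz by auto
  then obtain k where k: "k \<in> ground M" "k \<notin> s" "k \<notin> b" "z \<in> fundamental_circuit M s k"
    using element_avoiding_cocircuit[OF assms(2) s(1), of y z] xyz(4) by blast
  let ?D = "fundamental_circuit M s k"
  have D: "?D \<in> circuits M" "?D \<subseteq> insert k s"
    using fundamental_circuit_circuit[OF s(1) k(1,2)] fundamental_circuit_subset[OF s(1) k(1,2)]
    by blast+
  then have "?D \<inter> b \<subseteq> {y, z}"
    using sb k(3) by blast
  moreover have "z \<in> ?D \<inter> b"
    using k(4) sb by blast
  \<comment> \<open>Since a circuit and a cocircuit never share exactly one element,
    \<open>y\<close> has to lie in the circuit as well.\<close>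
  moreover have "?D \<inter> b \<noteq> {z}"
    by (rule circuit_cocircuit_inter_not_singleton[OF D(1) assms(2)])
  ultimately have yz: "{y, z} \<subseteq> ?D"
    by blast
  let ?I = "insert k (s - {y, z})"
  have "insert k (s - {z}) \<in> indep M"
    using k(4) fundamental_circuit_eq[OF s(1) k(1,2)] sb k(2) by auto
  then have "?I \<in> indep M"
    by (rule indep_mono) blast
  moreover have x: "x \<in> ground M" "x \<in> b" "x \<in> C"
    using assms(1) xyz(1) unfolding circuits_iff by blast+
  moreover have "?I \<inter> b = {}"
    using sb k(3) by blast
  moreover have "s \<subseteq> ground M"
    using s(1) base_indep indep_subset_ground by blast
  ultimately have I: "insert x ?I \<in> indep M"
  proof -
    \<comment> \<open>Without \<open>x\<close> this set is independent and avoids \<open>b\<close>,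
      so a circuit inside it would meet \<open>b\<close> in \<open>x\<close> alone.\<close>
    have False if dep: "insert x ?I \<notin> indep M"
    proof -
      obtain C' where C': "C' \<in> circuits M" "C' \<subseteq> insert x ?I"
        using dependent_includes_circuit[OF _ dep] x(1) k(1) \<open>s \<subseteq> ground M\<close> by blast
      have "x \<in> C'"
        using C' \<open>?I \<in> indep M\<close> indep_mono[of ?I C'] unfolding circuits_iff by blast
      then have "C' \<inter> b = {x}"
        using C'(2) x(2) \<open>?I \<inter> b = {}\<close> by blast
      then show False
        using circuit_cocircuit_inter_not_singleton[OF C'(1) assms(2)] by blast
    qed
    then show ?thesis
      by blast
  qed
  have "k \<noteq> x" "k \<noteq> y" "k \<noteq> z"
    using k(3) xyz(1) by blast+
  then have "card {x, y, z, k} = 4"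
    using xyz by simp
  moreover have "y \<in> s" "z \<in> s" "{y, z} \<subseteq> C"
    using sb xyz(1) by blast+
  moreover have "{x, y, z, k} \<subseteq> ground M"
    using x(1) k(1) sb \<open>s \<subseteq> ground M\<close> by blast
  ultimately show ?thesis
    using that s(1,4,5) k(2) yz I by blast
qed

text \<open>Descent on \<open>card (C \<inter> b)\<close>: replacing \<open>z\<close> by \<open>x\<close> in a suitable base turns the fundamental
  circuit \<open>D\<close> of \<open>k\<close> into a circuit meeting \<open>b\<close> in exactly \<open>(C \<inter> b) - D\<close>; here the absence of
  intersections of size 3 is used.\<close>

lemma even_card_circuit_cocircuit_inter:
  assumes fin: "\<forall>C\<in>circuits M. \<forall>b\<in>cocircuits M. finite (C \<inter> b)"
    and no3: "\<forall>C\<in>circuits M. \<forall>b\<in>cocircuits M. card (C \<inter> b) \<noteq> 3"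
    and b: "b \<in> cocircuits M"
  shows "C \<in> circuits M \<Longrightarrow> even (card (C \<inter> b))"
proof (induction "card (C \<inter> b)" arbitrary: C rule: less_induct)
  case less
  note C = less.prems
  show ?case
  proof (rule ccontr)
    assume odd: "odd (card (C \<inter> b))"
    have finC: "finite (C \<inter> b)"
      using fin C b by blast
    have "card (C \<inter> b) \<noteq> 1"
      using circuit_cocircuit_inter_not_singleton[OF C b] by (auto simp: card_1_singleton_iff)
    then have card3: "card (C \<inter> b) \<ge> 3"
      using odd by presburger
    then have "C \<inter> b \<noteq> {}"
      by auto
    then obtain x where x: "x \<in> C" "x \<in> b"
      by blast
    obtain s where s: "s \<in> bases M" "C - {x} \<subseteq> s" "s \<inter> b = C \<inter> b - {x}" "x \<notin> s"
      "fundamental_circuit M s x = C"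
      using base_adapted_to_circuit_cocircuit[OF C b, of x] x by blast
    have "card (s \<inter> b) \<ge> 2"
      using s(3) card3 finC x by simp
    then obtain T where "T \<subseteq> s \<inter> b" "card T = 2"
      using obtain_subset_with_card_n by metis
    then obtain y z where yz: "y \<in> s \<inter> b" "z \<in> s \<inter> b" "y \<noteq> z"
      unfolding card_2_iff by blast
    obtain k where k: "k \<in> ground M" "k \<notin> s" "k \<notin> b" "z \<in> fundamental_circuit M s k"
      using element_avoiding_cocircuit[OF b s(1) yz] by blast
    define D where "D = fundamental_circuit M s k"
    have D: "D \<in> circuits M" "D \<subseteq> insert k s" "z \<in> D" "k \<in> D"
      using fundamental_circuit_circuit[OF s(1) k(1,2)]
        fundamental_circuit_subset[OF s(1) k(1,2)] k(4) unfolding D_def by blast+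
    have xG: "x \<in> ground M"
      using C x(1) unfolding circuits_iff by blast
    have z: "z \<in> s" "z \<in> b" "z \<in> C" "z \<noteq> x" "z \<in> ground M"
      using yz(2) s(3) C unfolding circuits_iff by blast+
    have DF: "D \<inter> b \<subseteq> C \<inter> b" "x \<notin> D"
      using D(2) s(3,4) k(3) x(2) by blast+
    have "card (D \<inter> b) < card (C \<inter> b)"
      by (rule psubset_card_mono[OF finC]) (use DF x in blast)
    then have evenD: "even (card (D \<inter> b))"
      using less.hyps D(1) by blast
    \<comment> \<open>In \<open>t\<close> the roles of \<open>x\<close> and \<open>z\<close> are
      swapped: \<open>C\<close> becomes the fundamental circuit of \<open>z\<close>. The fundamental
      circuits of \<open>k\<close> for \<open>s\<close> and for \<open>t\<close> are then compared
      inside \<open>b\<close>.\<close>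
    define t where "t = insert x (s - {z})"
    have "x \<in> fundamental_cocircuit M s z"
      using mem_fundamental_circuit_iff[OF s(1) xG s(4) z(1)] s(5) z(3) by blast
    then have "insert x (s - {z}) \<in> indep M"
      using z(4) unfolding fundamental_cocircuit_def by blast
    then have t: "t \<in> bases M"
      using swap_base[OF s(1) z(1) s(4)] unfolding t_def by blast
    have kt: "k \<notin> t" and zt: "z \<notin> t"
      using k(2,3) x(2) z(4) unfolding t_def by blast+
    have fcz: "fundamental_circuit M t z = C"
      by (rule fundamental_circuit_unique[OF t z(5) zt C]) (use s(2) in \<open>auto simp: t_def\<close>)
    define D' where "D' = fundamental_circuit M t k"
    have D': "D' \<in> circuits M" "D' \<subseteq> insert k t" "k \<in> D'"
      using fundamental_circuit_circuit[OF t k(1) kt]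
        fundamental_circuit_subset[OF t k(1) kt] unfolding D'_def by blast+
    \<comment> \<open>The fundamental cocircuit of \<open>w\<close> for \<open>t\<close> contains
      \<open>z\<close> because \<open>w \<in> C\<close>. The circuit \<open>D\<close> cannot meet it
      in \<open>z\<close> alone, and the only other candidate is \<open>k\<close>; so by duality
      \<open>w\<close> lies in \<open>D'\<close>.\<close>
    have sub: "w \<in> D'" if "w \<in> C \<inter> b" "w \<notin> D" for w
    proof -
      have w: "w \<in> t"
        using that s(2) D(3) unfolding t_def by blast
      let ?b = "fundamental_cocircuit M t w"
      have "z \<in> ?b"
        using mem_fundamental_circuit_iff[OF t z(5) zt w] fcz that(1) by blast
      moreover have "D \<inter> ?b \<noteq> {z}"
        by (rule circuit_cocircuit_inter_not_singleton[OF D(1)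
              fundamental_cocircuit_cocircuit[OF t w]])
      ultimately obtain e where e: "e \<in> D" "e \<in> ?b" "e \<noteq> z"
        using D(3) by blast
      have "e = k"
      proof (rule ccontr)
        assume "e \<noteq> k"
        then have "e \<in> t"
          using e D(2) unfolding t_def by blast
        then have "e = w"
          using fundamental_cocircuit_inter_base[OF w, of M] e(2) by auto
        then show False
          using that(2) e(1) by blast
      qed
      then show ?thesis
        using mem_fundamental_circuit_iff[OF t k(1) kt w] e(2) unfolding D'_def by blast
    qed
    \<comment> \<open>A common \<open>w\<close> would put \<open>w\<close>, \<open>x\<close> and
      \<open>k\<close> into the fundamental cocircuit of \<open>w\<close> for \<open>s\<close>. As
      \<open>D'\<close> contains all three and otherwise only elements of \<open>s\<close>, the two
      would meet in exactly three elements.\<close>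
    have disj: "w \<notin> D" if "w \<in> D'" "w \<in> b" for w
    proof
      assume "w \<in> D"
      then have w: "w \<in> s" "w \<in> C" "w \<noteq> x" "w \<noteq> k"
        using D(2) that(2) k(3) s(3) DF by blast+
      let ?b = "fundamental_cocircuit M s w"
      have "x \<in> ?b" "k \<in> ?b" "w \<in> ?b"
        using mem_fundamental_circuit_iff[OF s(1) xG s(4) w(1)] s(5) w(2)
          mem_fundamental_circuit_iff[OF s(1) k(1,2) w(1)] \<open>w \<in> D\<close>
        unfolding D_def fundamental_cocircuit_def by blast+
      moreover have "x \<in> D'"
        using sub x DF(2) by blast
      moreover have "?b \<inter> s = {w}"
        by (rule fundamental_cocircuit_inter_base[OF w(1)])
      ultimately have "D' \<inter> ?b = {w, x, k}"
        using D'(2,3) that(1) unfolding t_def by blast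
      moreover have "x \<noteq> k"
        using x(2) k(3) by blast
      ultimately have "card (D' \<inter> ?b) = 3"
        using w by simp
      then show False
        using no3 D'(1) fundamental_cocircuit_cocircuit[OF s(1) w(1)] by blast
    qed
    have "D' \<inter> b \<subseteq> C \<inter> b"
      using D'(2) k(3) s(3) x unfolding t_def by blast
    then have eq: "D' \<inter> b = C \<inter> b - D \<inter> b"
      using sub disj by blast
    then have card: "card (D' \<inter> b) = card (C \<inter> b) - card (D \<inter> b)"
      using card_Diff_subset[OF finite_subset[OF DF(1) finC] DF(1)] by simp
    moreover have "card (D' \<inter> b) < card (C \<inter> b)"
      by (rule psubset_card_mono[OF finC]) (use eq D(3) z in blast)
    then have "even (card (D' \<inter> b))"
      using less.hyps D'(1) by blast
    ultimately show False
      using odd evenD \<open>card (D \<inter> b) < card (C \<inter> b)\<close> by presburger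
  qed
qed

section \<open>Contraction and minors isomorphic to \<open>U_{2,4}\<close>\<close>

text \<open>With \<open>I\<close> a maximal independent subset of \<open>C\<close>, the bases of the
  contraction are the sets \<open>t - C\<close> for bases \<open>t\<close> including
  \<open>I\<close>. This resolves the double dual in the definition.\<close>

lemma indep_contraction_iff:
  assumes "C \<subseteq> ground M" "I \<in> indep M" "I \<subseteq> C" "\<forall>x\<in>C. insert x I \<in> indep M \<longrightarrow> x \<in> I"
  shows "J \<in> indep (contraction M C) \<longleftrightarrow> J \<inter> C = {} \<and> J \<union> I \<in> indep M"
proof -
  \<comment> \<open>\<open>F\<close> consists of the independent sets of the dual with
    \<open>C\<close> deleted; the complements of its maximal members in \<open>ground M - C\<close>
    are the bases of the contraction.\<close>
  define F where "F = {K. (\<exists>B\<in>bases M. K \<subseteq> ground M - B) \<and> K \<inter> C = {}}"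
  have contr: "J \<in> indep (contraction M C) \<longleftrightarrow>
      (\<exists>K\<in>maximal_sets F. J \<subseteq> ground M - C - K)"
    by (simp add: contraction_def deletion_def dual_def bases_def F_def)
  have ground: "B \<subseteq> ground M" if "B \<in> bases M" for B
    using that base_indep indep_subset_ground by blast
  \<comment> \<open>Any base can be traded for one that includes \<open>I\<close> and gains no
    elements outside \<open>C\<close>.\<close>
  have base: "\<exists>t\<in>bases M. I \<subseteq> t \<and> t \<subseteq> B \<union> C" if B: "B \<in> bases M" for B
  proof -
    have BC: "I \<subseteq> B \<union> C" "B \<union> C \<subseteq> ground M"
      using assms(1,3) ground[OF B] by blast+
    obtain t where "t \<in> bases M" "I \<subseteq> t" "t \<subseteq> B \<union> C"
      by (rule extend_within_to_base[OF assms(2) BC B Un_upper1])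
    then show ?thesis
      by blast
  qed
  have meet: "t \<inter> C = I" if "t \<in> bases M" "I \<subseteq> t" for t
  proof -
    have "x \<in> I" if "x \<in> t" "x \<in> C" for x
      using assms(4) that indep_mono[OF base_indep[OF \<open>t \<in> bases M\<close>], of "insert x I"]
        \<open>I \<subseteq> t\<close> by blast
    with that(2) assms(3) show ?thesis
      by blast
  qed
  show ?thesis
    unfolding contr
  proof
    assume "\<exists>K\<in>maximal_sets F. J \<subseteq> ground M - C - K"
    then obtain K where K: "K \<in> F" "\<forall>L\<in>F. K \<subseteq> L \<longrightarrow> L = K" "J \<subseteq> ground M - C - K"
      unfolding maximal_sets_def by blast
    obtain B where B: "B \<in> bases M" "K \<subseteq> ground M - B" "K \<inter> C = {}"
      using K(1) unfolding F_def by blast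
    obtain t where t: "t \<in> bases M" "I \<subseteq> t" "t \<subseteq> B \<union> C"
      using base[OF B(1)] by blast
    have "ground M - t - C \<in> F"
      using t(1) unfolding F_def by blast
    moreover have "K \<subseteq> ground M - t - C"
      using B t(3) by blast
    ultimately have "ground M - t - C = K"
      using K(2) by blast
    then have "J \<union> I \<subseteq> t"
      using K(3) t(2) by blast
    then show "J \<inter> C = {} \<and> J \<union> I \<in> indep M"
      using K(3) indep_mono[OF base_indep[OF t(1)]] by blast
  next
    assume J: "J \<inter> C = {} \<and> J \<union> I \<in> indep M"
    then obtain t where t: "t \<in> bases M" "J \<union> I \<subseteq> t"
      using extend_to_base by blast
    let ?K = "ground M - t - C"
    have "?K \<in> F"
      using t(1) unfolding F_def by blast
    \<comment> \<open>A larger \<open>L\<close> yields a base \<open>u\<close> that includes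
      \<open>I\<close> and lies in \<open>t\<close> outside \<open>C\<close>. Inside
      \<open>C\<close> both bases equal \<open>I\<close>, so \<open>u \<subseteq> t\<close> and the
      bases coincide.\<close>
    moreover have "L = ?K" if L: "L \<in> F" "?K \<subseteq> L" for L
    proof -
      obtain B where B: "B \<in> bases M" "L \<subseteq> ground M - B" "L \<inter> C = {}"
        using L(1) unfolding F_def by blast
      obtain u where u: "u \<in> bases M" "I \<subseteq> u" "u \<subseteq> B \<union> C"
        using base[OF B(1)] by blast
      have "u \<inter> C = I" "t \<inter> C = I"
        using meet u t by blast+
      moreover have "u - C \<subseteq> t"
        using u(3) B(2) L(2) ground[OF u(1)] by blast
      ultimately have "u \<subseteq> t"
        by blast
      then have "t = u"
        using base_subset_eq[OF u(1) base_indep[OF t(1)]] by blast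
      then show ?thesis
        using u(3) B L(2) by blast
    qed
    ultimately have "?K \<in> maximal_sets F"
      unfolding maximal_sets_def by blast
    moreover have "J \<subseteq> ground M - C - ?K"
      using J t ground[OF t(1)] by blast
    ultimately show "\<exists>K\<in>maximal_sets F. J \<subseteq> ground M - C - K"
      by blast
  qed
qed

text \<open>Contracting a set amounts to adjoining a maximal independent subset of it, which serves
  as \<open>S\<close>. Conversely, \<open>S\<close> is contracted and everything else outside
  \<open>Q\<close> is deleted.\<close>

lemma U24_minor_iff:
  "(\<exists>N\<in>minors M. isomorphic N (uniform_matroid 2 4)) \<longleftrightarrow>
    (\<exists>Q S. Q \<subseteq> ground M \<and> card Q = 4 \<and> S \<inter> Q = {} \<and>
      (\<forall>J. J \<subseteq> Q \<longrightarrow> (J \<union> S \<in> indep M \<longleftrightarrow> card J \<le> 2)))"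
proof
  assume "\<exists>N\<in>minors M. isomorphic N (uniform_matroid 2 4)"
  then obtain N where N: "N \<in> minors M" "isomorphic N (uniform_matroid 2 4)"
    by blast
  obtain C D where CD: "C \<subseteq> ground M" "D \<subseteq> ground M" "C \<inter> D = {}"
    and N_eq: "N = deletion (contraction M C) D"
    using N(1) unfolding minors_def by blast
  have ground: "ground N = ground M - C - D"
    by (simp add: N_eq deletion_def contraction_def dual_def)
  have indep: "J \<in> indep N \<longleftrightarrow> J \<in> indep (contraction M C) \<and> J \<inter> D = {}" for J
    by (simp add: N_eq deletion_def)
  obtain \<phi> where bij: "bij_betw \<phi> (ground M - C - D) {..<4::nat}"
    and iso: "\<forall>J. J \<subseteq> ground M - C - D \<longrightarrow>
      (J \<in> indep (contraction M C) \<and> J \<inter> D = {} \<longleftrightarrow> \<phi> ` J \<subseteq> {..<4} \<and> card (\<phi> ` J) \<le> 2)"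
    using N(2) unfolding isomorphic_def ground indep by (auto simp: uniform_matroid_def)
  obtain I where I: "I \<in> indep M" "{} \<subseteq> I" "I \<subseteq> C"
    "\<forall>x\<in>C. insert x I \<in> indep M \<longrightarrow> x \<in> I"
    by (rule extend_within[OF empty_indep empty_subsetI CD(1)])
  have "J \<union> I \<in> indep M \<longleftrightarrow> card J \<le> 2" if J: "J \<subseteq> ground M - C - D" for J
  proof -
    have "\<phi> ` J \<subseteq> {..<4}" "card (\<phi> ` J) = card J"
      using bij J unfolding bij_betw_def by (blast, metis card_image inj_on_subset)
    moreover have "J \<inter> D = {}" "J \<inter> C = {}"
      using J by blast+
    ultimately show ?thesis
      using iso[rule_format, OF J] indep_contraction_iff[OF CD(1) I(1,3,4), of J] by simp
  qed
  moreover have "card (ground M - C - D) = 4"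
    using bij_betw_same_card[OF bij] by simp
  moreover have "I \<inter> (ground M - C - D) = {}" "ground M - C - D \<subseteq> ground M"
    using I(3) by blast+
  ultimately show "\<exists>Q S. Q \<subseteq> ground M \<and> card Q = 4 \<and> S \<inter> Q = {} \<and>
      (\<forall>J. J \<subseteq> Q \<longrightarrow> (J \<union> S \<in> indep M \<longleftrightarrow> card J \<le> 2))"
    by (intro exI[of _ "ground M - C - D"] exI[of _ I] conjI allI impI)
next
  assume "\<exists>Q S. Q \<subseteq> ground M \<and> card Q = 4 \<and> S \<inter> Q = {} \<and>
      (\<forall>J. J \<subseteq> Q \<longrightarrow> (J \<union> S \<in> indep M \<longleftrightarrow> card J \<le> 2))"
  then obtain Q S where Q: "Q \<subseteq> ground M" "card Q = 4" "S \<inter> Q = {}"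
    and ind: "\<And>J. J \<subseteq> Q \<Longrightarrow> J \<union> S \<in> indep M \<longleftrightarrow> card J \<le> 2"
    by blast
  have S: "S \<in> indep M"
    using ind[of "{}"] by simp
  let ?D = "ground M - S - Q"
  let ?N = "deletion (contraction M S) ?D"
  have SG: "S \<subseteq> ground M"
    using S by (rule indep_subset_ground)
  have groundN: "ground ?N = Q"
    using SG Q by (auto simp: deletion_def contraction_def dual_def)
  have contr: "J \<in> indep (contraction M S) \<longleftrightarrow> J \<inter> S = {} \<and> J \<union> S \<in> indep M" for J
    using indep_contraction_iff[OF SG S] by blast
  have "finite Q"
    using Q(2) by (metis card.infinite zero_neq_numeral)
  then obtain \<phi> where bij: "bij_betw \<phi> Q {..<4::nat}"
    using finite_same_card_bij[of Q "{..<4::nat}"] Q(2) by auto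
  have "J \<in> indep ?N \<longleftrightarrow> \<phi> ` J \<in> indep (uniform_matroid 2 4)" if J: "J \<subseteq> Q" for J
  proof -
    have "\<phi> ` J \<subseteq> {..<4}" "card (\<phi> ` J) = card J"
      using bij J unfolding bij_betw_def by (blast, metis card_image inj_on_subset)
    moreover have "J \<inter> ?D = {}" "J \<inter> S = {}"
      using J Q(3) by blast+
    ultimately show ?thesis
      using contr ind[OF J] by (simp add: deletion_def uniform_matroid_def)
  qed
  then have "isomorphic ?N (uniform_matroid 2 4)"
    using bij unfolding isomorphic_def groundN by (auto simp: uniform_matroid_def)
  moreover have "?N \<in> minors M"
    unfolding minors_def using SG by blast
  ultimately show "\<exists>N\<in>minors M. isomorphic N (uniform_matroid 2 4)"
    by blast
qed

text \<open>With \<open>S = s - {y, z}\<close>, the pair \<open>{y, z}\<close> and the four pairs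
  reached by a single exchange complete \<open>S\<close> to bases, while \<open>{x, k}\<close> is
  only known to give an independent set. Every triple includes one of the five, so it is dependent
  over \<open>S\<close>.\<close>

lemma U24_minor_if_three_element_intersection:
  assumes "C \<in> circuits M" "b \<in> cocircuits M" "card (C \<inter> b) = 3"
  shows "\<exists>N\<in>minors M. isomorphic N (uniform_matroid 2 4)"
proof -
  obtain s x y z k where s: "s \<in> bases M" and Q: "card {x, y, z, k} = 4"
    and mem: "y \<in> s" "z \<in> s" "x \<notin> s" "k \<notin> s" and QG: "{x, y, z, k} \<subseteq> ground M"
    and C: "fundamental_circuit M s x = C" "{y, z} \<subseteq> C"
    and D: "{y, z} \<subseteq> fundamental_circuit M s k"
    and xk: "insert x (insert k (s - {y, z})) \<in> indep M"
    by (rule three_element_intersection_configuration[OF assms])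
  have ne: "x \<noteq> y" "x \<noteq> z" "x \<noteq> k" "y \<noteq> z" "y \<noteq> k" "z \<noteq> k"
    using Q by (auto simp: card_insert_if split: if_splits)
  define S where "S = s - {y, z}"
  have notin: "x \<notin> S" "y \<notin> S" "z \<notin> S" "k \<notin> S"
    using mem unfolding S_def by blast+
  have swap: "insert e (s - {w}) \<in> bases M"
    if "e \<in> {x, k}" "w \<in> {y, z}" for e w
  proof -
    have e: "e \<in> ground M" "e \<notin> s" "w \<in> s" "w \<in> fundamental_circuit M s e" "w \<noteq> e"
      using that QG mem C D by auto
    then have "insert e (s - {w}) \<in> indep M"
      using fundamental_circuit_eq[OF s e(1,2)] by auto
    then show ?thesis
      using swap_base[OF s e(3,2)] by blast
  qed
  have eqs: "insert e (s - {y}) = {z, e} \<union> S" "insert e (s - {z}) = {y, e} \<union> S"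
    "{y, z} \<union> S = s" for e
    using ne mem unfolding S_def by auto
  have pair_base: "{z, x} \<union> S \<in> bases M" "{z, k} \<union> S \<in> bases M" "{y, x} \<union> S \<in> bases M"
    "{y, k} \<union> S \<in> bases M" "{y, z} \<union> S \<in> bases M"
    using swap[of x y] swap[of x z] swap[of k y] swap[of k z] s eqs by simp_all
  have pair: "{p, q} \<union> S \<in> indep M" if "p \<in> {x, y, z, k}" "q \<in> {x, y, z, k}" for p q
  proof -
    have "{x, k} \<union> S \<in> indep M"
      using xk unfolding S_def by simp
    moreover have "{p, q} \<union> S \<subseteq> {x, k} \<union> S \<or> {p, q} \<union> S \<subseteq> {z, x} \<union> S \<or> {p, q} \<union> S \<subseteq> {z, k} \<union> S \<or>
        {p, q} \<union> S \<subseteq> {y, x} \<union> S \<or> {p, q} \<union> S \<subseteq> {y, k} \<union> S \<or> {p, q} \<union> S \<subseteq> {y, z} \<union> S"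
      using that by auto
    ultimately show ?thesis
      using pair_base[THEN base_indep] by (elim disjE) (erule (1) indep_mono[rotated])+
  qed
  have triple: "T \<union> S \<notin> indep M" if T: "T \<subseteq> {x, y, z, k}" "card T = 3" for T
  proof
    assume TS: "T \<union> S \<in> indep M"
    have "card ({x, y, z, k} - T) = 1"
      using T Q card_Diff_subset[of T "{x, y, z, k}"] finite_subset[OF T(1)] by simp
    then obtain w where "{x, y, z, k} - T = {w}"
      by (auto simp: card_1_singleton_iff)
    then have w: "w \<in> {x, y, z, k}" "T = {x, y, z, k} - {w}"
      using T(1) by blast+
    \<comment> \<open>Each triple is listed with a pair in front that completes \<open>S\<close> to
      a base.\<close>
    then have "T = {y, z, k} \<or> T = {z, x, k} \<or> T = {y, x, k} \<or> T = {y, z, x}"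
      using ne by auto
    then have "\<exists>p q r. T = {p, q, r} \<and> p \<noteq> r \<and> q \<noteq> r \<and> {p, q} \<union> S \<in> bases M \<and> r \<notin> S"
      using pair_base ne notin by (elim disjE) blast+
    then obtain p q r where pqr: "T = {p, q, r}" "p \<noteq> r" "q \<noteq> r"
      "{p, q} \<union> S \<in> bases M" "r \<notin> S"
      by blast
    then have "insert r ({p, q} \<union> S) \<in> indep M"
      using TS by (simp add: insert_commute)
    then show False
      using base_insert_dependent[OF pqr(4), of r] pqr by blast
  qed
  have "J \<union> S \<in> indep M \<longleftrightarrow> card J \<le> 2" if J: "J \<subseteq> {x, y, z, k}" for J
  proof
    assume JS: "J \<union> S \<in> indep M"
    show "card J \<le> 2"
    proof (rule ccontr)
      assume "\<not> card J \<le> 2"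
      then have "3 \<le> card J"
        by simp
      then obtain T where T: "T \<subseteq> J" "card T = 3"
        using obtain_subset_with_card_n by metis
      then have "T \<union> S \<in> indep M"
        using JS indep_mono by blast
      then show False
        using triple[of T] T J by blast
    qed
  next
    assume "card J \<le> 2"
    moreover have "finite J"
      using J finite_subset by blast
    ultimately consider "J = {}" | p where "J = {p}" | p q where "J = {p, q}"
      by (metis card_1_singletonE card_2_iff card_0_eq le_Suc_eq le_zero_eq numeral_2_eq_2 One_nat_def)
    then have "\<exists>p q. p \<in> {x, y, z, k} \<and> q \<in> {x, y, z, k} \<and> J \<subseteq> {p, q}"
    proof cases
      case 1
      then show ?thesis
        by blast
    next
      case (2 p)
      then show ?thesis
        using J by (intro exI[of _ p]) simp
    next
      case (3 p q)
      then show ?thesis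
        using J by (intro exI[of _ p] exI[of _ q]) simp
    qed
    then obtain p q where "p \<in> {x, y, z, k}" "q \<in> {x, y, z, k}" "J \<subseteq> {p, q}"
      by blast
    then show "J \<union> S \<in> indep M"
      using indep_mono[OF pair[of p q], of "J \<union> S"] by blast
  qed
  moreover have "S \<inter> {x, y, z, k} = {}"
    using notin by blast
  ultimately show ?thesis
    unfolding U24_minor_iff using Q QG by blast
qed

text \<open>For \<open>Q = {p, q, r, t}\<close>, a circuit through \<open>p\<close>,
  \<open>q\<close>, \<open>r\<close> has its other elements in \<open>S\<close>. The fundamental
  cocircuit of \<open>p\<close> for a base including \<open>{p, t} \<union> S\<close> contains
  \<open>q\<close> and \<open>r\<close> and meets the base only in \<open>p\<close>.\<close>

lemma three_element_intersection_if_U24_minor: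
  assumes "\<exists>N\<in>minors M. isomorphic N (uniform_matroid 2 4)"
  shows "\<exists>C\<in>circuits M. \<exists>b\<in>cocircuits M. card (C \<inter> b) = 3"
proof -
  obtain Q S where Q: "Q \<subseteq> ground M" "card Q = 4" "S \<inter> Q = {}"
    and ind: "\<And>J. J \<subseteq> Q \<Longrightarrow> J \<union> S \<in> indep M \<longleftrightarrow> card J \<le> 2"
    using assms unfolding U24_minor_iff by blast
  obtain p R where "Q = insert p R" "p \<notin> R" "card R = 3"
    using Q(2) card_Suc_eq[of Q 3] by auto
  then obtain q r t where pqrt: "Q = {p, q, r, t}" "p \<noteq> q" "p \<noteq> r" "p \<noteq> t"
    "q \<noteq> r" "q \<noteq> t" "r \<noteq> t"
    unfolding card_3_iff by blast
  have S: "S \<subseteq> ground M"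
    using ind[of "{}"] indep_subset_ground by simp
  have circ: "\<exists>C\<in>circuits M. {u, v, w} \<subseteq> C \<and> C \<subseteq> {u, v, w} \<union> S"
    if "{u, v, w} \<subseteq> Q" "u \<noteq> v" "u \<noteq> w" "v \<noteq> w" for u v w
  proof -
    have "{u, v, w} \<union> S \<notin> indep M"
      using ind[OF that(1)] that(2-4) by simp
    moreover have "{u, v, w} \<union> S \<subseteq> ground M"
      using that(1) S Q(1) by blast
    ultimately obtain C where C: "C \<in> circuits M" "C \<subseteq> {u, v, w} \<union> S"
      using dependent_includes_circuit by blast
    \<comment> \<open>Without \<open>a\<close> the circuit would lie in the union of
      \<open>S\<close> and at most two elements of \<open>Q\<close>, which is independent.\<close>
    have "a \<in> C" if a: "a \<in> {u, v, w}" for a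
    proof (rule ccontr)
      assume "a \<notin> C"
      then have "C \<subseteq> ({u, v, w} - {a}) \<union> S"
        using C(2) by blast
      moreover have "card ({u, v, w} - {a}) \<le> 2"
        using a \<open>u \<noteq> v\<close> \<open>u \<noteq> w\<close> \<open>v \<noteq> w\<close> by (subst card_Diff_singleton) simp_all
      then have "({u, v, w} - {a}) \<union> S \<in> indep M"
        using ind[of "{u, v, w} - {a}"] \<open>{u, v, w} \<subseteq> Q\<close> by blast
      ultimately have "C \<in> indep M"
        using indep_mono by blast
      then show False
        using C(1) unfolding circuits_iff by blast
    qed
    with C show ?thesis
      by blast
  qed
  have "{p, t} \<union> S \<in> indep M"
    using ind[of "{p, t}"] pqrt by simp
  then obtain s where s: "s \<in> bases M" "{p, t} \<union> S \<subseteq> s"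
    using extend_to_base by blast
  have ps: "p \<in> s"
    using s(2) by blast
  let ?b = "fundamental_cocircuit M s p"
  have mem: "e \<in> ?b" if e: "e \<in> {q, r}" for e
  proof -
    have eG: "e \<in> ground M" "{p, t, e} \<subseteq> Q" "p \<noteq> e" "t \<noteq> e"
      using e Q(1) pqrt by auto
    then have "card {p, t, e} = 3"
      using pqrt by simp
    then have "{p, t, e} \<union> S \<notin> indep M"
      using ind[OF eG(2)] by simp
    then have es: "e \<notin> s"
      using indep_mono[OF base_indep[OF s(1)], of "{p, t, e} \<union> S"] s(2) by blast
    obtain C where C: "C \<in> circuits M" "{p, t, e} \<subseteq> C" "C \<subseteq> {p, t, e} \<union> S"
      using circ[OF eG(2)] eG pqrt by blast
    have "fundamental_circuit M s e = C"
      by (rule fundamental_circuit_unique[OF s(1) eG(1) es C(1)]) (use C(3) s(2) in blast)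
    then show ?thesis
      using mem_fundamental_circuit_iff[OF s(1) eG(1) es ps] C(2) by blast
  qed
  obtain C where C: "C \<in> circuits M" "{p, q, r} \<subseteq> C" "C \<subseteq> {p, q, r} \<union> S"
    using circ[of p q r] pqrt by auto
  have "?b \<inter> s = {p}"
    by (rule fundamental_cocircuit_inter_base[OF ps])
  then have "C \<inter> ?b = {p, q, r}"
    using C mem s(2) by blast
  then have "card (C \<inter> ?b) = 3"
    using pqrt by simp
  then show ?thesis
    using C(1) fundamental_cocircuit_cocircuit[OF s(1) ps] by blast
qed

section \<open>Symmetric differences and disjoint unions of circuits\<close>

lemma no_three_element_intersection_if_sym_diff:
  assumes "\<forall>C1\<in>circuits M. \<forall>C2\<in>circuits M.
       sym_diff C1 C2 = {} \<or> (\<exists>C\<in>circuits M. C \<subseteq> sym_diff C1 C2)"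
    and "C \<in> circuits M" "b \<in> cocircuits M"
  shows "card (C \<inter> b) \<noteq> 3"
proof
  assume "card (C \<inter> b) = 3"
  then obtain s x y z k where s: "s \<in> bases M" and Q: "card {x, y, z, k} = 4"
    and mem: "y \<in> s" "z \<in> s" "x \<notin> s" "k \<notin> s" and QG: "{x, y, z, k} \<subseteq> ground M"
    and C: "fundamental_circuit M s x = C" "{y, z} \<subseteq> C"
    and D: "{y, z} \<subseteq> fundamental_circuit M s k"
    and xk: "insert x (insert k (s - {y, z})) \<in> indep M"
    by (rule three_element_intersection_configuration[OF assms(2,3)])
  let ?D = "fundamental_circuit M s k"
  have ne: "x \<noteq> y" "x \<noteq> z" "x \<noteq> k" "y \<noteq> k" "z \<noteq> k"
    using Q by (auto simp: card_insert_if split: if_splits)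
  have xk_ground: "x \<in> ground M" "k \<in> ground M"
    using QG by blast+
  have sub: "C \<subseteq> insert x s" "x \<in> C" "?D \<subseteq> insert k s"
    using fundamental_circuit_subset[OF s xk_ground(1) mem(3)]
      fundamental_circuit_subset[OF s xk_ground(2) mem(4)] C(1)
    by blast+
  then have "x \<in> sym_diff C ?D"
    using ne mem by blast
  moreover have "?D \<in> circuits M"
    by (rule fundamental_circuit_circuit[OF s xk_ground(2) mem(4)])
  ultimately obtain C' where C': "C' \<in> circuits M" "C' \<subseteq> sym_diff C ?D"
    using assms(1,2) by blast
  moreover have "sym_diff C ?D \<subseteq> insert x (insert k (s - {y, z}))"
    using sub C(2) D by blast
  ultimately show False
    using indep_mono[OF xk, of C'] unfolding circuits_iff by blast
qed

text \<open>If \<open>Y\<close> lay in a base, the fundamental cocircuit of any of its elements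
  would meet \<open>Y\<close> in that element alone. An infinite intersection has
  \<open>card\<close> 0 and passes as even here.\<close>

lemma even_intersections_include_circuit:
  assumes "Y \<subseteq> ground M" "Y \<noteq> {}" "\<forall>b\<in>cocircuits M. even (card (Y \<inter> b))"
  obtains C where "C \<in> circuits M" "C \<subseteq> Y"
proof -
  have "Y \<notin> indep M"
  proof
    assume "Y \<in> indep M"
    then obtain s where s: "s \<in> bases M" "Y \<subseteq> s"
      using extend_to_base by blast
    obtain x where x: "x \<in> Y"
      using assms(2) by blast
    then have "x \<in> s"
      using s(2) by blast
    then have "Y \<inter> fundamental_cocircuit M s x = {x}"
      using fundamental_cocircuit_inter_base[of x s M] s(2) x by auto
    then have "card (Y \<inter> fundamental_cocircuit M s x) = 1"
      by simp
    then show False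
      using assms(3) fundamental_cocircuit_cocircuit[OF s(1) \<open>x \<in> s\<close>] by (metis odd_one)
  qed
  then show ?thesis
    using dependent_includes_circuit[OF assms(1)] that by blast
qed

text \<open>Zorn's lemma gives a maximal disjoint family of circuits inside \<open>Y\<close>. The
  remainder still meets every cocircuit evenly, so if nonempty it would include a further
  circuit.\<close>

lemma disjoint_union_of_circuits_if_even:
  assumes "Y \<subseteq> ground M"
    and Y: "\<forall>b\<in>cocircuits M. finite (Y \<inter> b) \<and> even (card (Y \<inter> b))"
    and even: "\<forall>C\<in>circuits M. \<forall>b\<in>cocircuits M. even (card (C \<inter> b))"
  shows "disjoint_union_of_circuits M Y"
proof -
  let ?A = "{\<C>. \<C> \<subseteq> circuits M \<and> pairwise disjnt \<C> \<and> \<Union>\<C> \<subseteq> Y}"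
  have "\<exists>\<C>\<in>?A. \<forall>\<D>\<in>?A. \<C> \<subseteq> \<D> \<longrightarrow> \<D> = \<C>"
  proof (rule subset_Zorn')
    fix K
    assume K: "subset.chain ?A K"
    have KA: "K \<subseteq> ?A"
      using K unfolding subset_chain_def by (rule conjunct1)
    have chain: "\<forall>A\<in>K. \<forall>B\<in>K. A \<subseteq> B \<or> B \<subseteq> A"
      using K unfolding subset_chain_def by (rule conjunct2)
    have "pairwise disjnt (\<Union>K)"
    proof (rule pairwiseI)
      fix C D
      assume "C \<in> \<Union>K" "D \<in> \<Union>K" "C \<noteq> D"
      then obtain \<C> where \<C>: "\<C> \<in> K" "C \<in> \<C>" "D \<in> \<C>"
        using chain by blast
      then have "pairwise disjnt \<C>"
        using KA by blast
      then show "disjnt C D"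
        by (rule pairwiseD[OF _ \<C>(2,3) \<open>C \<noteq> D\<close>])
    qed
    then show "\<Union>K \<in> ?A"
      using KA by blast
  qed
  then obtain \<C> where \<C>: "\<C> \<subseteq> circuits M" "pairwise disjnt \<C>" "\<Union>\<C> \<subseteq> Y"
    and max: "\<forall>\<D>\<in>?A. \<C> \<subseteq> \<D> \<longrightarrow> \<D> = \<C>"
    by blast
  have evens: "even (card ((Y - \<Union>\<C>) \<inter> b))" if b: "b \<in> cocircuits M" for b
  proof -
    let ?P = "(\<lambda>C. C \<inter> b) ` \<C>"
    have U: "\<Union>?P = \<Union>\<C> \<inter> b"
      by blast
    have finU: "finite (\<Union>\<C> \<inter> b)"
      by (rule finite_subset[of _ "Y \<inter> b"]) (use \<C>(3) Y b in blast)+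
    \<comment> \<open>The traces on \<open>b\<close> partition a finite set. Distinct circuits of
      the family can share only the empty trace, so passing to the set of traces loses
      nothing.\<close>
    have "2 dvd card (\<Union>?P)"
    proof (rule dvd_partition)
      show "finite (\<Union>?P)"
        using finU U by simp
      show "\<forall>c\<in>?P. 2 dvd card c"
        using even b \<C>(1) by blast
      show "\<forall>c1\<in>?P. \<forall>c2\<in>?P. c1 \<noteq> c2 \<longrightarrow> c1 \<inter> c2 = {}"
        using \<C>(2) unfolding pairwise_def disjnt_def by blast
    qed
    then have "even (card (\<Union>\<C> \<inter> b))"
      using U by simp
    moreover have "(Y - \<Union>\<C>) \<inter> b = Y \<inter> b - \<Union>\<C> \<inter> b"
      by blast
    moreover have "\<Union>\<C> \<inter> b \<subseteq> Y \<inter> b"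
      using \<C>(3) by blast
    ultimately show ?thesis
      using Y b card_Diff_subset[OF finU] card_mono[of "Y \<inter> b" "\<Union>\<C> \<inter> b"] by simp
  qed
  have "Y - \<Union>\<C> = {}"
  proof (rule ccontr)
    assume "Y - \<Union>\<C> \<noteq> {}"
    moreover have "Y - \<Union>\<C> \<subseteq> ground M"
      using assms(1) by blast
    ultimately obtain C where C: "C \<in> circuits M" "C \<subseteq> Y - \<Union>\<C>"
      using evens even_intersections_include_circuit by metis
    then have "insert C \<C> \<in> ?A"
      using \<C> by (auto simp: pairwise_insert disjnt_def)
    then have "insert C \<C> = \<C>"
      using bspec[OF max] by (metis subset_insertI)
    then have "C \<in> \<C>"
      by blast
    then have "C = {}"
      using C(2) by blast
    then show False
      using C(1) empty_indep unfolding circuits_iff by blast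
  qed
  then have "\<Union>\<C> = Y"
    using \<C>(3) by blast
  then show ?thesis
    using \<C> unfolding disjoint_union_of_circuits_def by blast
qed

lemma symdiff_circuits_inter_cocircuit:
  assumes even: "\<forall>C\<in>circuits M. \<forall>b\<in>cocircuits M. finite (C \<inter> b) \<and> even (card (C \<inter> b))"
    and "finite I" "\<forall>i\<in>I. X i \<in> circuits M"
  shows "symdiff I X \<subseteq> ground M \<and>
    (\<forall>b\<in>cocircuits M. finite (symdiff I X \<inter> b) \<and> even (card (symdiff I X \<inter> b)))"
  using assms(2,3)
proof (induction I rule: finite_induct)
  case empty
  then show ?case
    by (simp add: symdiff_def)
next
  case (insert i I)
  then have IH: "symdiff I X \<subseteq> ground M"
    "\<forall>b\<in>cocircuits M. finite (symdiff I X \<inter> b) \<and> even (card (symdiff I X \<inter> b))"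
    and i: "X i \<in> circuits M"
    by simp_all
  have eq: "symdiff (insert i I) X = sym_diff (X i) (symdiff I X)"
    by (rule symdiff_insert[OF insert.hyps])
  have "finite (symdiff (insert i I) X \<inter> b) \<and> even (card (symdiff (insert i I) X \<inter> b))"
    if b: "b \<in> cocircuits M" for b
  proof -
    have "symdiff (insert i I) X \<inter> b = sym_diff (X i \<inter> b) (symdiff I X \<inter> b)"
      unfolding eq by blast
    moreover have "finite (X i \<inter> b)" "even (card (X i \<inter> b))"
      "finite (symdiff I X \<inter> b)" "even (card (symdiff I X \<inter> b))"
      using even i b IH(2) by blast+
    ultimately show ?thesis
      using even_card_sym_diff by (metis finite_Diff finite_Un)
  qed
  moreover have "symdiff (insert i I) X \<subseteq> ground M"
    using IH(1) i unfolding eq circuits_iff by blast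
  ultimately show ?case
    by blast
qed

section \<open>Expansion of a circuit over a base\<close>

text \<open>This turns the number of fundamental circuits covering \<open>x\<close> into the size of
  an intersection with a cocircuit.\<close>

lemma fundamental_circuits_through:
  assumes "s \<in> bases M" "C \<in> circuits M" "x \<in> s"
  shows "{e \<in> C - s. x \<in> fundamental_circuit M s e} = C \<inter> fundamental_cocircuit M s x - {x}"
proof -
  have "x \<in> fundamental_circuit M s e \<longleftrightarrow> e \<in> fundamental_cocircuit M s x" if "e \<in> C - s" for e
    using mem_fundamental_circuit_iff[OF assms(1) _ _ assms(3)] that assms(2)
    unfolding circuits_iff by blast
  then show ?thesis
    using fundamental_cocircuit_inter_base[OF assms(3), of M] assms(3) by auto
qed

text \<open>An \<open>x \<in> s\<close> is covered \<open>card (C \<inter> b - {x})\<close> times,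
  where \<open>b\<close> is its fundamental cocircuit; this is odd exactly if
  \<open>x \<in> C\<close>. An \<open>x\<close> outside \<open>s\<close> lies in no fundamental
  circuit but its own.\<close>

lemma circuit_eq_symdiff_if_even:
  assumes even: "\<forall>C\<in>circuits M. \<forall>b\<in>cocircuits M. finite (C \<inter> b) \<and> even (card (C \<inter> b))"
    and s: "s \<in> bases M" and C: "C \<in> circuits M"
  shows "symdiff_defined (C - s) (fundamental_circuit M s) \<and>
    C = symdiff (C - s) (fundamental_circuit M s)"
proof -
  have *: "finite {e \<in> C - s. x \<in> fundamental_circuit M s e} \<and>
      (odd (card {e \<in> C - s. x \<in> fundamental_circuit M s e}) \<longleftrightarrow> x \<in> C)" for x
  proof (cases "x \<in> s")
    case True
    let ?b = "fundamental_cocircuit M s x"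
    have fin: "finite (C \<inter> ?b)" and "even (card (C \<inter> ?b))"
      using even C fundamental_cocircuit_cocircuit[OF s True] by blast+
    moreover have "x \<in> ?b"
      unfolding fundamental_cocircuit_def by blast
    moreover have "odd (card (C \<inter> ?b - {x})) \<longleftrightarrow> x \<in> C"
    proof (cases "x \<in> C")
      case True
      then have "card (C \<inter> ?b) = Suc (card (C \<inter> ?b - {x}))"
        using calculation by (intro card.remove[OF fin]) blast
      then show ?thesis
        using True \<open>even (card (C \<inter> ?b))\<close> by simp
    qed (use calculation in simp)
    ultimately show ?thesis
      unfolding fundamental_circuits_through[OF s C True] by blast
  next
    case False
    have "x \<in> fundamental_circuit M s e \<longleftrightarrow> x = e" if "e \<in> C - s" for e
      using fundamental_circuit_subset[OF s, of e] that C False unfolding circuits_iff by blast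
    then have "{e \<in> C - s. x \<in> fundamental_circuit M s e} = (if x \<in> C then {x} else {})"
      using False by auto
    then show ?thesis
      by simp
  qed
  then show ?thesis
    unfolding symdiff_defined_def symdiff_def by blast
qed

text \<open>For a base meeting \<open>b\<close> only in \<open>x \<in> C\<close>, the fundamental
  cocircuit of \<open>x\<close> is \<open>b\<close>, so \<open>C \<inter> b - {x}\<close> has odd
  size.\<close>

lemma even_if_circuit_eq_symdiff:
  assumes fin: "finite (C \<inter> b)"
    and eq: "\<forall>s\<in>bases M. C = symdiff (C - s) (fundamental_circuit M s)"
    and C: "C \<in> circuits M" and b: "b \<in> cocircuits M"
  shows "even (card (C \<inter> b))"
proof (cases "C \<inter> b = {}")
  case False
  then obtain x where x: "x \<in> C \<inter> b"
    by blast
  then obtain s where s: "s \<in> bases M" "s \<inter> b = {x}"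
    using cocircuit_meets_base_once[OF b] by blast
  have "x \<in> symdiff (C - s) (fundamental_circuit M s)"
    using eq s(1) x by blast
  moreover have "x \<in> s"
    using s(2) by blast
  ultimately have "odd (card (C \<inter> b - {x}))"
    using fundamental_circuits_through[OF s(1) C] cocircuit_eq_fundamental[OF b s]
    by (simp add: symdiff_def)
  then show ?thesis
    using card.remove[OF fin x] by simp
qed simp

section \<open>Thin sums over the two-element field\<close>

text \<open>Each element is represented by its incidence function on the cocircuits. The supports of
  thin dependences are then the sets meeting every cocircuit in a finite even set: circuits are
  among them, and each nonempty one includes a circuit.\<close>

lemma thin_sums_matroid_if_even:
  assumes even: "\<forall>C\<in>circuits M. \<forall>b\<in>cocircuits M. finite (C \<inter> b) \<and> even (card (C \<inter> b))"
  shows "thin_sums_matroid TYPE(bit) M"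
proof (rule thin_sums_matroidI[OF matroid])
  let ?f = "\<lambda>e b. of_bool (e \<in> b) :: bit"
  let ?l = "\<lambda>X e. of_bool (e \<in> X) :: bit"
  have thin: "thin_dependence (ground M) (cocircuits M) ?f l \<longleftrightarrow>
      (\<forall>b\<in>cocircuits M. finite ({e \<in> ground M. l e \<noteq> 0} \<inter> b) \<and>
        even (card ({e \<in> ground M. l e \<noteq> 0} \<inter> b)))" for l
  proof -
    have set: "{e \<in> ground M. l e * ?f e b \<noteq> 0} = {e \<in> ground M. l e \<noteq> 0} \<inter> b" for b
      by auto
    have "(\<Sum>e\<in>{e \<in> ground M. l e \<noteq> 0} \<inter> b. l e * ?f e b) =
        of_nat (card ({e \<in> ground M. l e \<noteq> 0} \<inter> b))" for b
    proof -
      have "(\<Sum>e\<in>{e \<in> ground M. l e \<noteq> 0} \<inter> b. l e * ?f e b) =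
          (\<Sum>e\<in>{e \<in> ground M. l e \<noteq> 0} \<inter> b. 1)"
        by (intro sum.cong) (auto simp: bit_not_zero_iff)
      then show ?thesis
        by simp
    qed
    then show ?thesis
      unfolding thin_dependence_def set by (simp add: of_nat_bit_eq_0_iff)
  qed
  have "X \<in> indep M \<longleftrightarrow> thinly_independent (ground M) (cocircuits M) ?f X" for X
  proof
    assume X: "X \<in> indep M"
    have "\<forall>e\<in>ground M. l e = 0"
      if l: "thin_dependence (ground M) (cocircuits M) ?f l" "\<forall>e\<in>ground M - X. l e = 0" for l
    proof (rule ccontr)
      assume "\<not> (\<forall>e\<in>ground M. l e = 0)"
      then have "{e \<in> ground M. l e \<noteq> 0} \<noteq> {}"
        by blast
      then obtain C where "C \<in> circuits M" "C \<subseteq> {e \<in> ground M. l e \<noteq> 0}"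
        using even_intersections_include_circuit[of "{e \<in> ground M. l e \<noteq> 0}"] l(1)
        unfolding thin by blast
      moreover from this have "C \<subseteq> X"
        using l(2) by blast
      ultimately show False
        using indep_mono[OF X] unfolding circuits_iff by blast
    qed
    then show "thinly_independent (ground M) (cocircuits M) ?f X"
      using indep_subset_ground[OF X] unfolding thinly_independent_def by blast
  next
    assume X: "thinly_independent (ground M) (cocircuits M) ?f X"
    show "X \<in> indep M"
    proof (rule ccontr)
      assume "X \<notin> indep M"
      then obtain C where C: "C \<in> circuits M" "C \<subseteq> X"
        using dependent_includes_circuit X unfolding thinly_independent_def by blast
      have "{e \<in> ground M. ?l C e \<noteq> 0} = C"
        using C(1) unfolding circuits_iff by auto
      then have "thin_dependence (ground M) (cocircuits M) ?f (?l C)"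
        using even C(1) unfolding thin by simp
      moreover have "\<forall>e\<in>ground M - X. ?l C e = 0"
        using C(2) by auto
      ultimately have "\<forall>e\<in>ground M. ?l C e = 0"
        using X unfolding thinly_independent_def by blast
      then have "C = {}"
        using \<open>{e \<in> ground M. ?l C e \<noteq> 0} = C\<close> by blast
      then show False
        using C(1) empty_indep unfolding circuits_iff by blast
    qed
  qed
  then show "indep M = {I. thinly_independent (ground M) (cocircuits M) ?f I}"
    by blast
qed

end

text \<open>At each \<open>a\<close> both families have finitely many nonzero terms, so all sums can
  be taken over the union of the two finite supports.\<close>

lemma thin_dependence_add:
  assumes "thin_dependence E A f l" "thin_dependence E A f m"
  shows "thin_dependence E A f (\<lambda>e. l e + m e)"
  unfolding thin_dependence_def
proof
  fix a
  assume a: "a \<in> A"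
  let ?S = "\<lambda>l. {e \<in> E. l e * f e a \<noteq> 0}"
  let ?U = "?S l \<union> ?S m"
  have fin: "finite (?S l)" "finite (?S m)"
    and zero: "(\<Sum>e\<in>?S l. l e * f e a) = 0" "(\<Sum>e\<in>?S m. m e * f e a) = 0"
    using assms a unfolding thin_dependence_def by blast+
  have sub: "?S (\<lambda>e. l e + m e) \<subseteq> ?U"
    by (auto simp: distrib_right)
  have "(\<Sum>e\<in>?S (\<lambda>e. l e + m e). (l e + m e) * f e a) = (\<Sum>e\<in>?U. (l e + m e) * f e a)"
    using fin sub by (intro sum.mono_neutral_left) auto
  also have "\<dots> = (\<Sum>e\<in>?U. l e * f e a) + (\<Sum>e\<in>?U. m e * f e a)"
    by (simp add: distrib_right sum.distrib)
  also have "(\<Sum>e\<in>?U. l e * f e a) = (\<Sum>e\<in>?S l. l e * f e a)"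
    using fin by (intro sum.mono_neutral_right) auto
  also have "(\<Sum>e\<in>?U. m e * f e a) = (\<Sum>e\<in>?S m. m e * f e a)"
    using fin by (intro sum.mono_neutral_right) auto
  finally show "finite (?S (\<lambda>e. l e + m e)) \<and>
      (\<Sum>e\<in>?S (\<lambda>e. l e + m e). (l e + m e) * f e a) = 0"
    using zero fin sub finite_subset by auto
qed

text \<open>By minimality every circuit is the support of a thin dependence. Since 1 + 1 = 0, the
  sum of two dependences is supported on the symmetric difference.\<close>

lemma sym_diff_if_thin_sums_matroid:
  assumes "thin_sums_matroid TYPE(bit) M" "C1 \<in> circuits M" "C2 \<in> circuits M"
  shows "sym_diff C1 C2 = {} \<or> (\<exists>C\<in>circuits M. C \<subseteq> sym_diff C1 C2)"
proof -
  obtain A and f :: "'a \<Rightarrow> ('a \<Rightarrow> bit) \<Rightarrow> bit"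
    where M: "matroid M" and ind: "indep M = {I. thinly_independent (ground M) A f I}"
    using assms(1) unfolding thin_sums_matroid_def by blast
  have dep: "X \<notin> indep M"
    if "thin_dependence (ground M) A f l" "{e \<in> ground M. l e \<noteq> 0} \<subseteq> X"
      "{e \<in> ground M. l e \<noteq> 0} \<noteq> {}" for X l
    using that unfolding ind thinly_independent_def by blast
  have circ: "\<exists>l. thin_dependence (ground M) A f l \<and> {e \<in> ground M. l e \<noteq> 0} = C"
    if C: "C \<in> circuits M" for C
  proof -
    have "C \<subseteq> ground M" "\<not> thinly_independent (ground M) A f C"
      using C unfolding circuits_iff ind by blast+
    then obtain l where l: "thin_dependence (ground M) A f l" "\<forall>e\<in>ground M - C. l e = 0"
      "\<not> (\<forall>e\<in>ground M. l e = 0)"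
      unfolding thinly_independent_def by blast
    let ?S = "{e \<in> ground M. l e \<noteq> 0}"
    have "?S \<notin> indep M" "?S \<subseteq> C"
      using dep[OF l(1) subset_refl] l by blast+
    then have "?S = C"
      using C unfolding circuits_iff by blast
    with l(1) show ?thesis
      by blast
  qed
  obtain l where l: "thin_dependence (ground M) A f l" "{e \<in> ground M. l e \<noteq> 0} = C1"
    using circ[OF assms(2)] by blast
  obtain m where m: "thin_dependence (ground M) A f m" "{e \<in> ground M. m e \<noteq> 0} = C2"
    using circ[OF assms(3)] by blast
  have "l e + m e \<noteq> 0 \<longleftrightarrow> (l e \<noteq> 0) \<noteq> (m e \<noteq> 0)" for e
    by (cases "l e"; cases "m e") simp_all
  then have S: "{e \<in> ground M. l e + m e \<noteq> 0} = sym_diff C1 C2"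
    using l(2) m(2) by blast
  have "\<exists>C\<in>circuits M. C \<subseteq> sym_diff C1 C2" if "sym_diff C1 C2 \<noteq> {}"
  proof -
    have dependent: "sym_diff C1 C2 \<notin> indep M"
    proof (rule dep[OF thin_dependence_add[OF l(1) m(1)]])
      show "{e \<in> ground M. l e + m e \<noteq> 0} \<subseteq> sym_diff C1 C2" "{e \<in> ground M. l e + m e \<noteq> 0} \<noteq> {}"
        unfolding S using that by blast+
    qed
    have "sym_diff C1 C2 \<subseteq> ground M"
      using S by blast
    then obtain C where "C \<in> circuits M" "C \<subseteq> sym_diff C1 C2"
      by (rule dependent_includes_circuit[OF M _ dependent])
    then show ?thesis
      by blast
  qed
  then show ?thesis
    by blast
qed

section \<open>Equivalence of the nine conditions\<close>

lemma symdiff_pair: "symdiff {0, 1::nat} (\<lambda>i. if i = 0 then A else B) = sym_diff A B"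
proof -
  let ?X = "\<lambda>i::nat. if i = 0 then A else B"
  have "symdiff {0, 1} ?X = sym_diff A (symdiff {1} ?X)"
    using symdiff_insert[of "{1}" 0 ?X] by simp
  also have "symdiff {1} ?X = sym_diff B (symdiff {} ?X)"
    using symdiff_insert[of "{}" 1 ?X] by simp
  also have "symdiff {} ?X = {}"
    by (simp add: symdiff_def)
  finally show ?thesis
    by simp
qed

text \<open>The implications lead from \<open>P2\<close> through \<open>P1\<close> or
  \<open>P8\<close> to \<open>P5\<close>, then to \<open>P3\<close> and back, with \<open>P4\<close>
  attached to \<open>P3\<close> and \<open>P9\<close> to \<open>P2\<close>.\<close>

lemma all_equivalentI:
  assumes "P2 \<Longrightarrow> P1" "P1 \<Longrightarrow> P5" "P2 \<Longrightarrow> P8" "P8 \<Longrightarrow> P7" "P8 \<Longrightarrow> P6" "P7 \<Longrightarrow> P5" "P6 \<Longrightarrow> P5" "P5 \<Longrightarrow> P3"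
    "P3 \<Longrightarrow> P2" "P3 \<Longrightarrow> P4" "P4 \<Longrightarrow> P3" "P2 \<Longrightarrow> P9" "P9 \<Longrightarrow> P2"
  shows "all_equivalent [P1, P2, P3, P4, P5, P6, P7, P8, P9]"
proof -
  have "P1 \<longleftrightarrow> P2" "P3 \<longleftrightarrow> P2" "P4 \<longleftrightarrow> P2" "P5 \<longleftrightarrow> P2" "P6 \<longleftrightarrow> P2" "P7 \<longleftrightarrow> P2" "P8 \<longleftrightarrow> P2" "P9 \<longleftrightarrow> P2"
    using assms by blast+
  then show ?thesis
    by (simp add: all_equivalent_def)
qed

text \<open>Indexing finite families by sets of naturals loses nothing, as a finite index set can be
  renumbered. Finiteness accompanies evenness because an infinite set has \<open>card\<close> 0,
  which is even.\<close>

theorem theorem3p1: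
  fixes M :: "'a set_system"
  assumes "matroid M" and "tame M"
  shows "all_equivalent
    [thin_sums_matroid TYPE(bit) M,
     \<forall>C\<in>circuits M. \<forall>B\<in>cocircuits M. finite (C \<inter> B) \<and> even (card (C \<inter> B)),
     \<forall>C\<in>circuits M. \<forall>B\<in>cocircuits M. card (C \<inter> B) \<noteq> 3,
     \<not> (\<exists>N\<in>minors M. isomorphic N (uniform_matroid 2 4)),
     \<forall>C1\<in>circuits M. \<forall>C2\<in>circuits M.
       sym_diff C1 C2 = {} \<or> (\<exists>C\<in>circuits M. C \<subseteq> sym_diff C1 C2),
     \<forall>C1\<in>circuits M. \<forall>C2\<in>circuits M. disjoint_union_of_circuits M (sym_diff C1 C2),
     \<forall>(I :: nat set) X. finite I \<and> (\<forall>i\<in>I. X i \<in> circuits M) \<longrightarrow>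
       symdiff I X = {} \<or> (\<exists>C\<in>circuits M. C \<subseteq> symdiff I X),
     \<forall>(I :: nat set) X. finite I \<and> (\<forall>i\<in>I. X i \<in> circuits M) \<longrightarrow>
       disjoint_union_of_circuits M (symdiff I X),
     \<forall>s\<in>bases M. \<forall>C\<in>circuits M.
       symdiff_defined (C - s) (fundamental_circuit M s) \<and>
       C = symdiff (C - s) (fundamental_circuit M s)]"
    (is "all_equivalent [?P1, ?P2, ?P3, ?P4, ?P5, ?P6, ?P7, ?P8, ?P9]")
proof (rule all_equivalentI)
  have fin: "\<forall>C\<in>circuits M. \<forall>B\<in>cocircuits M. finite (C \<inter> B)"
    using assms(2) unfolding tame_def .
  show ?P1 if ?P2
    by (rule thin_sums_matroid_if_even[OF assms(1) that])
  show ?P5 if ?P1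
    using sym_diff_if_thin_sums_matroid[OF that] by blast
  show ?P8 if even: ?P2
  proof (intro allI impI)
    fix I :: "nat set" and X
    assume "finite I \<and> (\<forall>i\<in>I. X i \<in> circuits M)"
    then have "symdiff I X \<subseteq> ground M"
      "\<forall>b\<in>cocircuits M. finite (symdiff I X \<inter> b) \<and> even (card (symdiff I X \<inter> b))"
      using symdiff_circuits_inter_cocircuit[OF assms(1) even] by blast+
    then show "disjoint_union_of_circuits M (symdiff I X)"
      using disjoint_union_of_circuits_if_even[OF assms(1)] even by blast
  qed
  show ?P7 if P8: ?P8
    using P8 by (intro allI impI disjoint_union_of_circuits_cases) blast
  show ?P6 if P8: ?P8
  proof (intro ballI)
    fix C1 C2
    assume C: "C1 \<in> circuits M" "C2 \<in> circuits M"
    show "disjoint_union_of_circuits M (sym_diff C1 C2)"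
      using P8[rule_format, of "{0, 1}" "\<lambda>i. if i = 0 then C1 else C2"] C
      unfolding symdiff_pair by simp
  qed
  show ?P5 if P7: ?P7
  proof (intro ballI)
    fix C1 C2
    assume C: "C1 \<in> circuits M" "C2 \<in> circuits M"
    show "sym_diff C1 C2 = {} \<or> (\<exists>C\<in>circuits M. C \<subseteq> sym_diff C1 C2)"
      using P7[rule_format, of "{0, 1}" "\<lambda>i. if i = 0 then C1 else C2"] C
      unfolding symdiff_pair by simp
  qed
  show ?P5 if P6: ?P6
    using P6 by (intro ballI disjoint_union_of_circuits_cases) blast
  show ?P3 if ?P5
    using no_three_element_intersection_if_sym_diff[OF assms(1) that] by blast
  show ?P2 if ?P3
    using even_card_circuit_cocircuit_inter[OF assms(1) fin that] fin by blast
  show ?P4 if ?P3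
    using three_element_intersection_if_U24_minor[OF assms(1)] that by blast
  show ?P3 if ?P4
    using U24_minor_if_three_element_intersection[OF assms(1)] that by blast
  show ?P9 if ?P2
    by (intro ballI circuit_eq_symdiff_if_even[OF assms(1) that])
  show ?P2 if P9: ?P9
  proof (intro ballI conjI)
    fix C b
    assume C: "C \<in> circuits M" and b: "b \<in> cocircuits M"
    show "finite (C \<inter> b)"
      using fin C b by blast
    moreover have "\<forall>s\<in>bases M. C = symdiff (C - s) (fundamental_circuit M s)"
      using P9 C by simp
    ultimately show "even (card (C \<inter> b))"
      by (rule even_if_circuit_eq_symdiff[OF assms(1) _ _ C b])
  qed
qed

end
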